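(* Let $r\ge1$, let $n=2r$ or $n=2r+1$, and let $e\in\{1,-1\}$. Let $\varphi:{}^{\imath}\mathbf U\to\mathbf A_q$ be the homomorphism from the $\imath$quantum group to the modified $q$-Weyl algebra (for this $n$). Let $\Omega$ and $\omega$ be the anti-automorphisms of ${}^{\imath}\mathbf U$ and $\mathbf A_q$, and let $(\tau_i,T_i)=(\tau'_{i,e},T'_{i,e})$ or $(\tau''_{i,-e},T''_{i,-e})$, all as defined in the context. Then $$\omega\circ\varphi=\varphi\circ\Omega,\qquad T_i\circ\varphi=\varphi\circ\tau_i\quad\text{for all }1\le i\le\left[\tfrac{n+1}{2}\right].$$
   Context: Setup. Fix $r\ge1$, $n=2r$ or $n=2r+1$, $I=\{1,\dots,n\}$, $\rho_n(i)=n+1-i$, $N=[\frac{n+1}{2}]$ (so $N=r$ if $n=2r$, $N=r+1$ if $n=2r+1$). For $i,j\in I$: $i\cdot i=2$, $i\cdot j=-1$ if $|i-j|=1$, $i\cdot j=0$ otherwise. $e\in\{1,-1\}$ and $[x,y]_{\pm e}=xy-q^{\pm e}yx$. The $\imath$quantum group ${}^{\imath}\mathbf U$ (denoted $\mathbf U^{\jmath}$ if $n=2r$, $\mathbf U^{\imath}$ if $n=2r+1$) is the $\mathbb Q(q)$-algebra generated by $B_i$ ($i\in I$) and $K_i$ ($i\in I$, $\rho_n(i)\neq i$) with relations $K_iK_{\rho_n(i)}=1$; $K_iB_j=q^{j\cdot\rho_n(i)-j\cdot i}B_jK_i$; (it is understood that the $K_i$ commute with each other); $B_jB_i-B_iB_j=\delta_{\rho_n(i),j}\frac{K_i-K_{\rho_n(i)}}{q-q^{-1}}$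 if $i\cdot j=0$; $B_i^2B_j-(q+q^{-1})B_iB_jB_i+B_jB_i^2=\delta_{i,\rho_n(i)}B_j-\delta_{j,\rho_n(i)}(q+q^{-1})B_i(q^{-1}\varsigma_iK_i+q^2\varsigma_{\rho_n(i)}K_{\rho_n(i)})$ if $i\cdot j=-1$, where $\varsigma_i=\delta_{i,r}+q^{-1}\delta_{i,r+1}$. $\Omega$ is the ($\mathbb Q$-algebra) anti-automorphism of ${}^\imath\mathbf U$ with $\Omega(B_i)=B_{\rho_n(i)}$, $\Omega(K_i)=K_{\rho_n(i)}$, $\Omega(q)=q^{-1}$. The automorphisms $\tau'_{i,e},\tau''_{i,-e}$ of ${}^\imath\mathbf U$ ($1\le i\le N$) are the following (known, mutually inverse) $\mathbb Q(q)$-algebra automorphisms; generators $B_j$ not listed are fixed, and values on $K_j$ are given for $1\le j\le r$, the rest being determined by $K_{\rho_n(j)}=K_j^{-1}$. On $K_j$: for $i\le N-1$, $\tau'_{i,e}$ and $\tau''_{i,-e}$ send $K_i\mapsto K_{\rho_n(i)}$, $K_j\mapsto K_iK_j$ if $|i-j|=1$, and $K_j\mapsto K_j$ otherwise; for $i=N$ all $K_j$ are fixed. On $B_j$ for $i\le N-1$ (if $n=2r+1$ and $i=r$, the case $j=r+1$ is excluded here and treated below): $\tau'_{i,e}(B_i)=-B_{\rho_n(i)}K_{\rho_n(i)}^e$; $\tau'_{i,e}(B_{\rho_n(i)})=-K_i^eB_i$; $\tau'_{i,e}(B_j)=[B_i,B_j]_{-e}$ if $i\cdot j=-1$; $\tau'_{i,e}(B_j)=[B_j,B_{\rho_n(i)}]_e$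 if $\rho_n(i)\cdot j=-1$; $\tau''_{i,-e}(B_i)=-K_i^eB_{\rho_n(i)}$; $\tau''_{i,-e}(B_{\rho_n(i)})=-B_iK_{\rho_n(i)}^e$; $\tau''_{i,-e}(B_j)=[B_j,B_i]_{-e}$ if $i\cdot j=-1$; $\tau''_{i,-e}(B_j)=[B_{\rho_n(i)},B_j]_e$ if $\rho_n(i)\cdot j=-1$. For $n=2r+1$, $i=r$, $j=r+1$: $\tau'_{r,e}(B_{r+1})=[B_r,[B_{r+1},B_{r+2}]_e]_{-e}+B_{r+1}K_{\rho_n(r)}^e$, $\tau''_{r,-e}(B_{r+1})=[[B_r,B_{r+1}]_e,B_{r+2}]_{-e}+B_{r+1}K_{\rho_n(r)}^e$. For $n=2r$, $i=r$ (terms with indices outside $I$ omitted): $\tau'_{r,e}(B_{r-1})=q^{-e}[[B_{r-1},B_r]_e,B_{r+1}]_e-K_r^eB_{r-1}$, $\tau'_{r,e}(B_r)=K_r^eB_r$, $\tau'_{r,e}(B_{r+1})=B_{r+1}K_{\rho_n(r)}^e$, $\tau'_{r,e}(B_{r+2})=q^{-e}[[B_{r+2},B_{r+1}]_e,B_r]_e-B_{r+2}K_{\rho_n(r)}^e$; $\tau''_{r,-e}(B_{r-1})=q^{-e}[B_{r+1},[B_r,B_{r-1}]_e]_e-K_{\rho_n(r)}^eB_{r-1}$, $\tau''_{r,-e}(B_r)=K_{\rho_n(r)}^eB_r$, $\tau''_{r,-e}(B_{r+1})=B_{r+1}K_r^e$, $\tau''_{r,-e}(B_{r+2})=q^{-e}[B_r,[B_{r+1},B_{r+2}]_e]_e-B_{r+2}K_r^e$.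 For $n=2r+1$, $i=r+1$: $\tau'_{r+1,e}(B_r)=[B_{r+1},B_r]_{-e}$, $\tau'_{r+1,e}(B_{r+2})=[B_{r+2},B_{r+1}]_e$; $\tau''_{r+1,-e}(B_r)=[B_{r+1},B_r]_e$, $\tau''_{r+1,-e}(B_{r+2})=[B_{r+2},B_{r+1}]_{-e}$. The modified $q$-Weyl algebra $\mathbf A_q$ ($\mathbf A_q^\jmath$ if $n=2r$, $\mathbf A_q^\imath$ if $n=2r+1$): put $c_i=1$ for $i\le r$, $c_{r+1}=2$ if $n=2r$, $c_{r+1}=1$ if $n=2r+1$. It is the $\mathbb Q(q)$-algebra generated by $\mathfrak d_i,\mathfrak x_i,\mathfrak m_i^{\pm1}$ ($1\le i\le r+1$) with relations: $\mathfrak m_i\mathfrak m_i^{-1}=\mathfrak m_i^{-1}\mathfrak m_i=1$; all $\mathfrak m$'s commute, all $\mathfrak d$'s commute, all $\mathfrak x$'s commute; for $i\ne j$, $\mathfrak d_i\mathfrak m_j=\mathfrak m_j\mathfrak d_i$, $\mathfrak x_i\mathfrak m_j=\mathfrak m_j\mathfrak x_i$, $\mathfrak d_i\mathfrak x_j=\mathfrak x_j\mathfrak d_i$; $\mathfrak d_i\mathfrak m_i=q^{c_i}\mathfrak m_i\mathfrak d_i$, $\mathfrak x_i\mathfrak m_i=q^{-c_i}\mathfrak m_i\mathfrak x_i$; $\mathfrak d_i\mathfrak x_i=\frac{q^{c_i}\mathfrak m_i-q^{-c_i}\mathfrak m_i^{-1}}{q-q^{-1}}$, $\mathfrak x_i\mathfrak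 d_i=\frac{\mathfrak m_i-\mathfrak m_i^{-1}}{q-q^{-1}}$. $\omega$ is the ($\mathbb Q$-algebra) anti-automorphism of $\mathbf A_q$ with $\omega(\mathfrak x_i)=\mathfrak d_i$, $\omega(\mathfrak d_i)=\mathfrak x_i$, $\omega(\mathfrak m_i)=\mathfrak m_i^{-1}$, $\omega(q)=q^{-1}$. The $\mathbb Q(q)$-algebra automorphisms $T'_{i,e},T''_{i,-e}$ of $\mathbf A_q$ ($1\le i\le N$; generators not listed are fixed). For $i\le N-1$: both interchange $\mathfrak m_i$ and $\mathfrak m_{i+1}$; $T'_{i,e}(\mathfrak d_{i+1})=-q^{-e}\mathfrak m_{i+1}^{-e}\mathfrak d_i$, $T'_{i,e}(\mathfrak d_i)=\mathfrak m_i^{-e}\mathfrak d_{i+1}$, $T'_{i,e}(\mathfrak x_{i+1})=-q^{e}\mathfrak m_{i+1}^{e}\mathfrak x_i$, $T'_{i,e}(\mathfrak x_i)=\mathfrak m_i^{e}\mathfrak x_{i+1}$; $T''_{i,-e}(\mathfrak d_{i+1})=\mathfrak m_{i+1}^{e}\mathfrak d_i$, $T''_{i,-e}(\mathfrak d_i)=-q^{e}\mathfrak m_i^{e}\mathfrak d_{i+1}$, $T''_{i,-e}(\mathfrak x_{i+1})=\mathfrak m_{i+1}^{-e}\mathfrak x_i$, $T''_{i,-e}(\mathfrak x_i)=-q^{-e}\mathfrak m_i^{-e}\mathfrak x_{i+1}$. For $n=2r$, $i=r$: $T'_{r,e}(\mathfrak d_{r+1})=q^{e}\mathfrak m_r^{-2e}\mathfrak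 d_{r+1}$, $T'_{r,e}(\mathfrak d_r)=q^{-2e}\mathfrak m_r^{-e}\mathfrak m_{r+1}^{-e}\mathfrak d_r$, $T'_{r,e}(\mathfrak x_{r+1})=q^{-e}\mathfrak m_r^{2e}\mathfrak x_{r+1}$, $T'_{r,e}(\mathfrak x_r)=q^{e}\mathfrak m_r^{e}\mathfrak m_{r+1}^{e}\mathfrak x_r$; $T''_{r,-e}(\mathfrak d_{r+1})=q^{-e}\mathfrak m_r^{2e}\mathfrak d_{r+1}$, $T''_{r,-e}(\mathfrak d_r)=q^{2e}\mathfrak m_r^{e}\mathfrak m_{r+1}^{e}\mathfrak d_r$, $T''_{r,-e}(\mathfrak x_{r+1})=q^{e}\mathfrak m_r^{-2e}\mathfrak x_{r+1}$, $T''_{r,-e}(\mathfrak x_r)=q^{-e}\mathfrak m_r^{-e}\mathfrak m_{r+1}^{-e}\mathfrak x_r$. For $n=2r+1$, $i=r+1$: $T'_{r+1,e}(\mathfrak d_{r+1})=\mathfrak m_{r+1}^{-e}\mathfrak d_{r+1}$, $T'_{r+1,e}(\mathfrak x_{r+1})=q^{-e}\mathfrak m_{r+1}^{e}\mathfrak x_{r+1}$; $T''_{r+1,-e}(\mathfrak d_{r+1})=\mathfrak m_{r+1}^{e}\mathfrak d_{r+1}$, $T''_{r+1,-e}(\mathfrak x_{r+1})=q^{e}\mathfrak m_{r+1}^{-e}\mathfrak x_{r+1}$. The $\mathbb Q(q)$-algebra homomorphism $\varphi:{}^\imath\mathbf U\to\mathbf A_q$ (known to exist): $\varphi(B_i)=\mathfrak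 x_{i+1}\mathfrak d_i$ and $\varphi(B_{\rho_n(i)})=\mathfrak x_i\mathfrak d_{i+1}$ for $1\le i\le r$; $\varphi(B_{r+1})=\mathfrak x_{r+1}\mathfrak d_{r+1}$ if $n=2r+1$; if $n=2r$, $\varphi(K_i)=q^{-\delta_{i,r}}\mathfrak m_i\mathfrak m_{i+1}^{-1}$ for $1\le i\le r$; if $n=2r+1$, $\varphi(K_i)=\mathfrak m_i\mathfrak m_{i+1}^{-1}$ for $1\le i\le r$; and $\varphi(K_{\rho_n(i)})=\varphi(K_i)^{-1}$. *)

theory Defs
  imports
    "HOL-Library.Poly_Mapping"
    "HOL-Computational_Algebra.Polynomial"
    "HOL-Computational_Algebra.Fraction_Field"
    "HOL-Algebra.QuotRing"
begin

section \<open>Algebras over \<open>\<rat>(q)\<close> given by generators and relations\<close>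

type_synonym Qq = "rat poly fract"

definition qq :: Qq where
  "qq = Fraction_Field.Fract [:0, 1:] 1"

definition Qq_of_rat :: "rat \<Rightarrow> Qq" where
  "Qq_of_rat c = Fraction_Field.Fract [:c:] 1"

text \<open>Words under concatenation form the free monoid, written additively because the convolution
  product of \<^typ>\<open>'a \<Rightarrow>\<^sub>0 'b\<close> is taken over an additive index monoid.\<close>

datatype 'g word = Word (letters: "'g list")

instantiation word :: (type) monoid_add
begin
definition zero_word :: "'a word" where "0 = Word []"
definition plus_word :: "'a word \<Rightarrow> 'a word \<Rightarrow> 'a word"
  where "v + w = Word (letters v @ letters w)"
instance
  by standard (simp_all add: zero_word_def plus_word_def)
end

type_synonym 'g freealg = "'g word \<Rightarrow>\<^sub>0 Qq"

definition gen :: "'g \<Rightarrow> 'g freealg" where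
  "gen g = Poly_Mapping.single (Word [g]) 1"

definition scal :: "Qq \<Rightarrow> 'g freealg" where
  "scal c = Poly_Mapping.single 0 c"

abbreviation qs :: "int \<Rightarrow> 'g freealg" where
  "qs k \<equiv> scal (qq powi k)"

definition qbr :: "int \<Rightarrow> 'g freealg \<Rightarrow> 'g freealg \<Rightarrow> 'g freealg" where
  "qbr k x y = x * y - qs k * (y * x)"

definition free_ring :: "'g set \<Rightarrow> 'g freealg ring" where
  "free_ring X = \<lparr>carrier = {p. \<forall>w \<in> Poly_Mapping.keys p. set (letters w) \<subseteq> X},
     monoid.mult = (*), one = 1, zero = 0, add = (+)\<rparr>"

lemma ring_free_ring: "ring (free_ring Y)"
proof -
  let ?C = "carrier (free_ring Y)"
  have ops: "monoid.mult (free_ring Y) = (*)" "monoid.one (free_ring Y) = 1"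
    "ring.zero (free_ring Y) = 0" "ring.add (free_ring Y) = (+)"
    by (simp_all add: free_ring_def)
  have add: "p + p' \<in> ?C" if "p \<in> ?C" "p' \<in> ?C" for p p'
    using that Poly_Mapping.keys_add[of p p'] by (auto simp: free_ring_def)
  have mult: "p * p' \<in> ?C" if "p \<in> ?C" "p' \<in> ?C" for p p'
    using that keys_mult[of p p'] by (fastforce simp: free_ring_def plus_word_def)
  have minus: "- p \<in> ?C" if "p \<in> ?C" for p
    using that by (simp add: free_ring_def)
  have closed01: "0 \<in> ?C" "1 \<in> ?C"
    by (auto simp: free_ring_def zero_word_def)
  show ?thesis
  proof (rule ringI)
    show "abelian_group (free_ring Y)"
    proof (rule abelian_groupI, unfold ops)
      fix p assume "p \<in> ?C"
      then show "\<exists>p' \<in> ?C. p' + p = 0" using minus by (intro bexI[of _ "- p"]) auto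
    qed (auto simp: add closed01 add_ac)
    show "Group.monoid (free_ring Y)"
      by (rule monoidI, unfold ops) (auto simp: mult closed01 mult.assoc)
  qed (auto simp: ops algebra_simps)
qed

text \<open>A presentation is a pair of a set of generators and a set of relators; a relator \<open>p\<close>
  stands for the relation \<open>p = 0\<close>.\<close>

type_synonym 'g pres = "'g set \<times> 'g freealg set"

definition rel_ideal :: "'g pres \<Rightarrow> 'g freealg set" where
  "rel_ideal P = Idl\<^bsub>free_ring (fst P)\<^esub> (snd P)"

definition palg :: "'g pres \<Rightarrow> 'g freealg set ring" where
  "palg P = free_ring (fst P) Quot rel_ideal P"

definition cls :: "'g pres \<Rightarrow> 'g freealg \<Rightarrow> 'g freealg set" where
  "cls P p = rel_ideal P +>\<^bsub>free_ring (fst P)\<^esub> p"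

text \<open>The \<open>\<rat>(q)\<close>-algebra structure on \<^term>\<open>palg P\<close> is the central ring homomorphism
  \<open>c \<mapsto> cls P (scal c)\<close>. Maps are HOL functions on cosets, so only their values on the carrier
  are meaningful.\<close>

definition alg_hom ::
    "'g pres \<Rightarrow> 'h pres \<Rightarrow> ('g freealg set \<Rightarrow> 'h freealg set) \<Rightarrow> bool" where
  "alg_hom P P' h \<longleftrightarrow> h \<in> ring_hom (palg P) (palg P') \<and>
     (\<forall>c. h (cls P (scal c)) = cls P' (scal c))"

definition alg_aut :: "'g pres \<Rightarrow> ('g freealg set \<Rightarrow> 'g freealg set) \<Rightarrow> bool" where
  "alg_aut P h \<longleftrightarrow> alg_hom P P h \<and> bij_betw h (carrier (palg P)) (carrier (palg P))"

text \<open>Anti-automorphisms are only \<open>\<rat>\<close>-linear here: they are not required to fix \<open>q\<close>.\<close>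

definition rat_alg_antiaut :: "'g pres \<Rightarrow> ('g freealg set \<Rightarrow> 'g freealg set) \<Rightarrow> bool" where
  "rat_alg_antiaut P h \<longleftrightarrow>
     bij_betw h (carrier (palg P)) (carrier (palg P)) \<and>
     (\<forall>x \<in> carrier (palg P). \<forall>y \<in> carrier (palg P).
        h (x \<oplus>\<^bsub>palg P\<^esub> y) = h x \<oplus>\<^bsub>palg P\<^esub> h y \<and>
        h (x \<otimes>\<^bsub>palg P\<^esub> y) = h y \<otimes>\<^bsub>palg P\<^esub> h x) \<and>
     h \<one>\<^bsub>palg P\<^esub> = \<one>\<^bsub>palg P\<^esub> \<and>
     (\<forall>c. h (cls P (scal (Qq_of_rat c))) = cls P (scal (Qq_of_rat c)))"


section \<open>The \<open>\<imath>\<close>quantum group\<close>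

text \<open>\<open>n\<close> is \<open>2 * r\<close> or \<open>2 * r + 1\<close> throughout.\<close>

definition rho :: "nat \<Rightarrow> nat \<Rightarrow> nat" where
  "rho n i = n + 1 - i"

definition NN :: "nat \<Rightarrow> nat" where
  "NN n = (n + 1) div 2"

definition cdot :: "nat \<Rightarrow> nat \<Rightarrow> int" where
  "cdot i j = (if i = j then 2 else if i = j + 1 \<or> j = i + 1 then -1 else 0)"

datatype ugen = Bgen nat | Kgen nat

abbreviation \<B> :: "nat \<Rightarrow> ugen freealg" where "\<B> i \<equiv> gen (Bgen i)"
abbreviation \<K> :: "nat \<Rightarrow> ugen freealg" where "\<K> i \<equiv> gen (Kgen i)"

definition Kidx :: "nat \<Rightarrow> nat set" where
  "Kidx n = {i \<in> {1..n}. rho n i \<noteq> i}"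

text \<open>Integer powers of \<open>K\<^sub>i\<close>, using that \<open>K\<^bsub>\<rho>(i)\<^esub>\<close> represents the inverse of \<open>K\<^sub>i\<close>.\<close>

definition Kpow :: "nat \<Rightarrow> nat \<Rightarrow> int \<Rightarrow> ugen freealg" where
  "Kpow n i k = (if k \<ge> 0 then \<K> i ^ nat k else \<K> (rho n i) ^ nat (- k))"

definition sigma :: "nat \<Rightarrow> nat \<Rightarrow> Qq" where
  "sigma r i = (if i = r then 1 else if i = r + 1 then inverse qq else 0)"

definition ugens :: "nat \<Rightarrow> ugen set" where
  "ugens n = Bgen ` {1..n} \<union> Kgen ` Kidx n"

definition urels :: "nat \<Rightarrow> nat \<Rightarrow> ugen freealg set" where
  "urels r n =
     {\<K> i * \<K> (rho n i) - 1 | i. i \<in> Kidx n} \<union>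
     {\<K> i * \<K> j - \<K> j * \<K> i | i j. i \<in> Kidx n \<and> j \<in> Kidx n} \<union>
     {\<K> i * \<B> j - qs (cdot j (rho n i) - cdot j i) * (\<B> j * \<K> i) | i j.
        i \<in> Kidx n \<and> j \<in> {1..n}} \<union>
     {\<B> j * \<B> i - \<B> i * \<B> j
        - (if rho n i = j then scal (inverse (qq - inverse qq)) * (\<K> i - \<K> (rho n i)) else 0) | i j.
        i \<in> {1..n} \<and> j \<in> {1..n} \<and> cdot i j = 0} \<union>
     {\<B> i ^ 2 * \<B> j - scal (qq + inverse qq) * (\<B> i * \<B> j * \<B> i) + \<B> j * \<B> i ^ 2
        - ((if i = rho n i then \<B> j else 0)
           - (if j = rho n i
              then scal (qq + inverse qq) *
                   (\<B> i * (scal (inverse qq * sigma r i) * \<K> i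
                           + scal (qq ^ 2 * sigma r (rho n i)) * \<K> (rho n i)))
              else 0)) | i j.
        i \<in> {1..n} \<and> j \<in> {1..n} \<and> cdot i j = -1}"

definition iqg :: "nat \<Rightarrow> nat \<Rightarrow> ugen pres" where
  "iqg r n = (ugens n, urels r n)"

definition is_Omega :: "nat \<Rightarrow> nat \<Rightarrow> (ugen freealg set \<Rightarrow> ugen freealg set) \<Rightarrow> bool" where
  "is_Omega r n \<Omega> \<longleftrightarrow> rat_alg_antiaut (iqg r n) \<Omega> \<and>
     (\<forall>i \<in> {1..n}. \<Omega> (cls (iqg r n) (\<B> i)) = cls (iqg r n) (\<B> (rho n i))) \<and>
     (\<forall>i \<in> Kidx n. \<Omega> (cls (iqg r n) (\<K> i)) = cls (iqg r n) (\<K> (rho n i))) \<and>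
     \<Omega> (cls (iqg r n) (scal qq)) = cls (iqg r n) (scal (inverse qq))"


subsection \<open>The automorphisms \<open>\<tau>'\<close> and \<open>\<tau>''\<close>\<close>

definition tau_K :: "nat \<Rightarrow> nat \<Rightarrow> nat \<Rightarrow> ugen freealg" where
  "tau_K n i j =
     (if i < NN n then
        if j = i then \<K> (rho n i)
        else if j = i + 1 \<or> i = j + 1 then \<K> i * \<K> j
        else \<K> j
      else \<K> j)"

definition tau'_B :: "nat \<Rightarrow> nat \<Rightarrow> int \<Rightarrow> nat \<Rightarrow> nat \<Rightarrow> ugen freealg" where
  "tau'_B r n e i j =
     (if i < NN n then
        if n = 2 * r + 1 \<and> i = r \<and> j = r + 1 then
          qbr (-e) (\<B> r) (qbr e (\<B> (r + 1)) (\<B> (r + 2))) + \<B> (r + 1) * Kpow n (rho n r) e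
        else if j = i then - (\<B> (rho n i) * Kpow n (rho n i) e)
        else if j = rho n i then - (Kpow n i e * \<B> i)
        else if cdot i j = -1 then qbr (-e) (\<B> i) (\<B> j)
        else if cdot (rho n i) j = -1 then qbr e (\<B> j) (\<B> (rho n i))
        else \<B> j
      else if n = 2 * r then
        if j = r - 1 then
          qs (-e) * qbr e (qbr e (\<B> (r - 1)) (\<B> r)) (\<B> (r + 1)) - Kpow n r e * \<B> (r - 1)
        else if j = r then Kpow n r e * \<B> r
        else if j = r + 1 then \<B> (r + 1) * Kpow n (rho n r) e
        else if j = r + 2 then
          qs (-e) * qbr e (qbr e (\<B> (r + 2)) (\<B> (r + 1))) (\<B> r) - \<B> (r + 2) * Kpow n (rho n r) e
        else \<B> j
      else
        if j = r then qbr (-e) (\<B> (r + 1)) (\<B> r)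
        else if j = r + 2 then qbr e (\<B> (r + 2)) (\<B> (r + 1))
        else \<B> j)"

definition tau''_B :: "nat \<Rightarrow> nat \<Rightarrow> int \<Rightarrow> nat \<Rightarrow> nat \<Rightarrow> ugen freealg" where
  "tau''_B r n e i j =
     (if i < NN n then
        if n = 2 * r + 1 \<and> i = r \<and> j = r + 1 then
          qbr (-e) (qbr e (\<B> r) (\<B> (r + 1))) (\<B> (r + 2)) + \<B> (r + 1) * Kpow n (rho n r) e
        else if j = i then - (Kpow n i e * \<B> (rho n i))
        else if j = rho n i then - (\<B> i * Kpow n (rho n i) e)
        else if cdot i j = -1 then qbr (-e) (\<B> j) (\<B> i)
        else if cdot (rho n i) j = -1 then qbr e (\<B> (rho n i)) (\<B> j)
        else \<B> j
      else if n = 2 * r then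
        if j = r - 1 then
          qs (-e) * qbr e (\<B> (r + 1)) (qbr e (\<B> r) (\<B> (r - 1))) - Kpow n (rho n r) e * \<B> (r - 1)
        else if j = r then Kpow n (rho n r) e * \<B> r
        else if j = r + 1 then \<B> (r + 1) * Kpow n r e
        else if j = r + 2 then
          qs (-e) * qbr e (\<B> r) (qbr e (\<B> (r + 1)) (\<B> (r + 2))) - \<B> (r + 2) * Kpow n r e
        else \<B> j
      else
        if j = r then qbr e (\<B> (r + 1)) (\<B> r)
        else if j = r + 2 then qbr (-e) (\<B> (r + 2)) (\<B> (r + 1))
        else \<B> j)"

text \<open>\<open>is_tau' r n e i\<close> characterises \<open>\<tau>'\<^bsub>i,e\<^esub>\<close>, while \<open>is_tau'' r n e i\<close> characterises
  \<open>\<tau>''\<^bsub>i,-e\<^esub>\<close> (note the sign). The values on the remaining \<open>K\<^bsub>\<rho>(j)\<^esub> = K\<^sub>j\<^sup>-\<^sup>1\<close> are forced.\<close>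

definition is_tau' :: "nat \<Rightarrow> nat \<Rightarrow> int \<Rightarrow> nat \<Rightarrow> (ugen freealg set \<Rightarrow> ugen freealg set) \<Rightarrow> bool" where
  "is_tau' r n e i \<tau> \<longleftrightarrow> alg_aut (iqg r n) \<tau> \<and>
     (\<forall>j \<in> {1..r}. \<tau> (cls (iqg r n) (\<K> j)) = cls (iqg r n) (tau_K n i j)) \<and>
     (\<forall>j \<in> {1..n}. \<tau> (cls (iqg r n) (\<B> j)) = cls (iqg r n) (tau'_B r n e i j))"

definition is_tau'' :: "nat \<Rightarrow> nat \<Rightarrow> int \<Rightarrow> nat \<Rightarrow> (ugen freealg set \<Rightarrow> ugen freealg set) \<Rightarrow> bool" where
  "is_tau'' r n e i \<tau> \<longleftrightarrow> alg_aut (iqg r n) \<tau> \<and>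
     (\<forall>j \<in> {1..r}. \<tau> (cls (iqg r n) (\<K> j)) = cls (iqg r n) (tau_K n i j)) \<and>
     (\<forall>j \<in> {1..n}. \<tau> (cls (iqg r n) (\<B> j)) = cls (iqg r n) (tau''_B r n e i j))"


section \<open>The modified \<open>q\<close>-Weyl algebra\<close>

datatype agen = Dgen nat | Xgen nat | Mgen nat | Minvgen nat

abbreviation \<dd> :: "nat \<Rightarrow> agen freealg" where "\<dd> i \<equiv> gen (Dgen i)"
abbreviation \<xx> :: "nat \<Rightarrow> agen freealg" where "\<xx> i \<equiv> gen (Xgen i)"
abbreviation \<mm> :: "nat \<Rightarrow> agen freealg" where "\<mm> i \<equiv> gen (Mgen i)"
abbreviation \<mm>inv :: "nat \<Rightarrow> agen freealg" where "\<mm>inv i \<equiv> gen (Minvgen i)"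

definition Mpow :: "nat \<Rightarrow> int \<Rightarrow> agen freealg" where
  "Mpow i k = (if k \<ge> 0 then \<mm> i ^ nat k else \<mm>inv i ^ nat (- k))"

definition cwt :: "nat \<Rightarrow> nat \<Rightarrow> nat \<Rightarrow> int" where
  "cwt r n i = (if i = r + 1 \<and> n = 2 * r then 2 else 1)"

definition agens :: "nat \<Rightarrow> agen set" where
  "agens r = (\<Union>i \<in> {1..r + 1}. {Dgen i, Xgen i, Mgen i, Minvgen i})"

definition arels :: "nat \<Rightarrow> nat \<Rightarrow> agen freealg set" where
  "arels r n =
     (\<Union>i \<in> {1..r + 1}.
        {\<mm> i * \<mm>inv i - 1,
         \<mm>inv i * \<mm> i - 1,
         \<dd> i * \<mm> i - qs (cwt r n i) * (\<mm> i * \<dd> i),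
         \<xx> i * \<mm> i - qs (- cwt r n i) * (\<mm> i * \<xx> i),
         \<dd> i * \<xx> i - scal (inverse (qq - inverse qq)) *
           (qs (cwt r n i) * \<mm> i - qs (- cwt r n i) * \<mm>inv i),
         \<xx> i * \<dd> i - scal (inverse (qq - inverse qq)) * (\<mm> i - \<mm>inv i)}) \<union>
     (\<Union>i \<in> {1..r + 1}. \<Union>j \<in> {1..r + 1}.
        {\<mm> i * \<mm> j - \<mm> j * \<mm> i,
         \<dd> i * \<dd> j - \<dd> j * \<dd> i,
         \<xx> i * \<xx> j - \<xx> j * \<xx> i}) \<union>
     (\<Union>i \<in> {1..r + 1}. \<Union>j \<in> {1..r + 1} - {i}.
        {\<dd> i * \<mm> j - \<mm> j * \<dd> i,
         \<xx> i * \<mm> j - \<mm> j * \<xx> i,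
         \<dd> i * \<xx> j - \<xx> j * \<dd> i})"

definition qweyl :: "nat \<Rightarrow> nat \<Rightarrow> agen pres" where
  "qweyl r n = (agens r, arels r n)"

definition is_omega :: "nat \<Rightarrow> nat \<Rightarrow> (agen freealg set \<Rightarrow> agen freealg set) \<Rightarrow> bool" where
  "is_omega r n \<omega> \<longleftrightarrow> rat_alg_antiaut (qweyl r n) \<omega> \<and>
     (\<forall>i \<in> {1..r + 1}.
        \<omega> (cls (qweyl r n) (\<xx> i)) = cls (qweyl r n) (\<dd> i) \<and>
        \<omega> (cls (qweyl r n) (\<dd> i)) = cls (qweyl r n) (\<xx> i) \<and>
        \<omega> (cls (qweyl r n) (\<mm> i)) = cls (qweyl r n) (\<mm>inv i)) \<and>
     \<omega> (cls (qweyl r n) (scal qq)) = cls (qweyl r n) (scal (inverse qq))"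


subsection \<open>The automorphisms \<open>T'\<close> and \<open>T''\<close>\<close>

definition T_M :: "nat \<Rightarrow> nat \<Rightarrow> nat \<Rightarrow> agen freealg" where
  "T_M n i j =
     (if i < NN n \<and> j = i then \<mm> (i + 1)
      else if i < NN n \<and> j = i + 1 then \<mm> i
      else \<mm> j)"

definition T'_D :: "nat \<Rightarrow> nat \<Rightarrow> int \<Rightarrow> nat \<Rightarrow> nat \<Rightarrow> agen freealg" where
  "T'_D r n e i j =
     (if i < NN n then
        if j = i + 1 then - (qs (-e) * Mpow (i + 1) (-e) * \<dd> i)
        else if j = i then Mpow i (-e) * \<dd> (i + 1)
        else \<dd> j
      else if n = 2 * r then
        if j = r + 1 then qs e * Mpow r (-2 * e) * \<dd> (r + 1)
        else if j = r then qs (-2 * e) * Mpow r (-e) * Mpow (r + 1) (-e) * \<dd> r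
        else \<dd> j
      else
        if j = r + 1 then Mpow (r + 1) (-e) * \<dd> (r + 1)
        else \<dd> j)"

definition T'_X :: "nat \<Rightarrow> nat \<Rightarrow> int \<Rightarrow> nat \<Rightarrow> nat \<Rightarrow> agen freealg" where
  "T'_X r n e i j =
     (if i < NN n then
        if j = i + 1 then - (qs e * Mpow (i + 1) e * \<xx> i)
        else if j = i then Mpow i e * \<xx> (i + 1)
        else \<xx> j
      else if n = 2 * r then
        if j = r + 1 then qs (-e) * Mpow r (2 * e) * \<xx> (r + 1)
        else if j = r then qs e * Mpow r e * Mpow (r + 1) e * \<xx> r
        else \<xx> j
      else
        if j = r + 1 then qs (-e) * Mpow (r + 1) e * \<xx> (r + 1)
        else \<xx> j)"

definition T''_D :: "nat \<Rightarrow> nat \<Rightarrow> int \<Rightarrow> nat \<Rightarrow> nat \<Rightarrow> agen freealg" where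
  "T''_D r n e i j =
     (if i < NN n then
        if j = i + 1 then Mpow (i + 1) e * \<dd> i
        else if j = i then - (qs e * Mpow i e * \<dd> (i + 1))
        else \<dd> j
      else if n = 2 * r then
        if j = r + 1 then qs (-e) * Mpow r (2 * e) * \<dd> (r + 1)
        else if j = r then qs (2 * e) * Mpow r e * Mpow (r + 1) e * \<dd> r
        else \<dd> j
      else
        if j = r + 1 then Mpow (r + 1) e * \<dd> (r + 1)
        else \<dd> j)"

definition T''_X :: "nat \<Rightarrow> nat \<Rightarrow> int \<Rightarrow> nat \<Rightarrow> nat \<Rightarrow> agen freealg" where
  "T''_X r n e i j =
     (if i < NN n then
        if j = i + 1 then Mpow (i + 1) (-e) * \<xx> i
        else if j = i then - (qs (-e) * Mpow i (-e) * \<xx> (i + 1))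
        else \<xx> j
      else if n = 2 * r then
        if j = r + 1 then qs e * Mpow r (-2 * e) * \<xx> (r + 1)
        else if j = r then qs (-e) * Mpow r (-e) * Mpow (r + 1) (-e) * \<xx> r
        else \<xx> j
      else
        if j = r + 1 then qs e * Mpow (r + 1) (-e) * \<xx> (r + 1)
        else \<xx> j)"

text \<open>As above, \<open>is_T'' r n e i\<close> characterises \<open>T''\<^bsub>i,-e\<^esub>\<close>. The values on \<open>\<mm>\<^sub>j\<^sup>-\<^sup>1\<close> are forced by
  those on \<open>\<mm>\<^sub>j\<close>.\<close>

definition is_T' :: "nat \<Rightarrow> nat \<Rightarrow> int \<Rightarrow> nat \<Rightarrow> (agen freealg set \<Rightarrow> agen freealg set) \<Rightarrow> bool" where
  "is_T' r n e i T \<longleftrightarrow> alg_aut (qweyl r n) T \<and>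
     (\<forall>j \<in> {1..r + 1}.
        T (cls (qweyl r n) (\<mm> j)) = cls (qweyl r n) (T_M n i j) \<and>
        T (cls (qweyl r n) (\<dd> j)) = cls (qweyl r n) (T'_D r n e i j) \<and>
        T (cls (qweyl r n) (\<xx> j)) = cls (qweyl r n) (T'_X r n e i j))"

definition is_T'' :: "nat \<Rightarrow> nat \<Rightarrow> int \<Rightarrow> nat \<Rightarrow> (agen freealg set \<Rightarrow> agen freealg set) \<Rightarrow> bool" where
  "is_T'' r n e i T \<longleftrightarrow> alg_aut (qweyl r n) T \<and>
     (\<forall>j \<in> {1..r + 1}.
        T (cls (qweyl r n) (\<mm> j)) = cls (qweyl r n) (T_M n i j) \<and>
        T (cls (qweyl r n) (\<dd> j)) = cls (qweyl r n) (T''_D r n e i j) \<and>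
        T (cls (qweyl r n) (\<xx> j)) = cls (qweyl r n) (T''_X r n e i j))"


section \<open>The homomorphism \<open>\<phi>\<close>\<close>

text \<open>The last conjunct writes out \<open>\<phi>(K\<^bsub>\<rho>(i)\<^esub>) = \<phi>(K\<^sub>i)\<^sup>-\<^sup>1\<close>.\<close>

definition is_phi :: "nat \<Rightarrow> nat \<Rightarrow> (ugen freealg set \<Rightarrow> agen freealg set) \<Rightarrow> bool" where
  "is_phi r n \<phi> \<longleftrightarrow> alg_hom (iqg r n) (qweyl r n) \<phi> \<and>
     (\<forall>i \<in> {1..r}.
        \<phi> (cls (iqg r n) (\<B> i)) = cls (qweyl r n) (\<xx> (i + 1) * \<dd> i) \<and>
        \<phi> (cls (iqg r n) (\<B> (rho n i))) = cls (qweyl r n) (\<xx> i * \<dd> (i + 1))) \<and>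
     (n = 2 * r + 1 \<longrightarrow>
        \<phi> (cls (iqg r n) (\<B> (r + 1))) = cls (qweyl r n) (\<xx> (r + 1) * \<dd> (r + 1))) \<and>
     (\<forall>i \<in> {1..r}.
        let k = (if n = 2 * r \<and> i = r then 1 else 0) in
        \<phi> (cls (iqg r n) (\<K> i)) = cls (qweyl r n) (qs (-k) * \<mm> i * \<mm>inv (i + 1)) \<and>
        \<phi> (cls (iqg r n) (\<K> (rho n i))) = cls (qweyl r n) (qs k * \<mm> (i + 1) * \<mm>inv i))"

end

theory Submission
  imports Defs
begin

text \<open>
  Both claims compare two maps out of the \<open>\<imath>\<close>quantum group which are both multiplicative
  (\<open>T\<^sub>i \<circ> \<phi>\<close> and \<open>\<phi> \<circ> \<tau>\<^sub>i\<close>) or both anti-multiplicative (\<open>\<omega> \<circ> \<phi>\<close> and \<open>\<phi> \<circ> \<Omega>\<close>). Two such maps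
  agree everywhere once they agree on scalars and generators (\<open>palg_induct\<close>). Scalars are
  automatic for \<open>\<rat>(q)\<close>-linear maps. The anti-automorphisms are only \<open>\<rat>\<close>-linear; there the
  scalars on which the two maps agree form a subfield of \<open>\<rat>(q)\<close> that contains \<open>\<rat>\<close> and \<open>q\<close>
  (\<open>Qq_induct\<close>). The values at \<open>K\<^bsub>\<rho>(j)\<^esub>\<close> and \<open>\<mm>\<^sub>j\<^sup>-\<^sup>1\<close> are forced, because inverses are unique. What
  remains is a finite list of identities in \<open>\<A>\<^sub>q\<close>, one for each position of \<open>j\<close> relative to \<open>i\<close>.

  The \<open>q\<close>-Weyl algebra consists of commuting rank one pieces, one for each index \<open>k\<close>, and
  \<open>\<phi>(B\<^sub>j)\<close> is a product \<open>\<xx>\<^sub>k\<dd>\<^sub>l\<close> of two generators with \<open>k\<close> and \<open>l\<close> equal or adjacent. If the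
  value \<open>\<tau>\<^sub>i(B\<^sub>j)\<close> is a monomial, both sides are monomials as well and differ at most in the order
  of the factors, so that only powers of \<open>q\<close> have to be compared (\<open>normal_form\<close>). If \<open>\<tau>\<^sub>i(B\<^sub>j)\<close> is a
  \<open>q\<close>-commutator, its two arguments share one index \<open>k\<close>; the factors with other indices can be
  pulled out (\<open>brk_factor\<close>), and what is left is a \<open>q\<close>-commutator of \<open>\<xx>\<^sub>k\<close> and \<open>\<dd>\<^sub>k\<close>. Since
  \<open>\<xx>\<^sub>k\<dd>\<^sub>k\<close> and \<open>\<dd>\<^sub>k\<xx>\<^sub>k\<close> are both linear combinations of \<open>\<mm>\<^sub>k\<close> and \<open>\<mm>\<^sub>k\<^sup>-\<^sup>1\<close>, the parameters
  \<open>q\<close> and \<open>q\<^sup>-\<^sup>1\<close> make one of the two terms vanish (\<open>brk_weight1\<close>); this is the origin of the single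
  factor \<open>\<mm>\<^sub>k\<^sup>\<plusminus>\<^sup>1\<close> in the values of \<open>T\<^sub>i\<close>.

  Two places need more. For \<open>n = 2r\<close> the index \<open>r + 1\<close> has weight \<open>2\<close>, and the plain commutator
  of \<open>\<dd>\<close> and \<open>\<xx>\<close> there is \<open>q\<mm> + q\<^sup>-\<^sup>1\<mm>\<^sup>-\<^sup>1\<close> (\<open>brk_weight2\<close>). One of these terms gives the value of \<open>T\<^sub>r\<close>,
  and the other is cancelled by the correction term with \<open>K\<^sub>r\<^sup>\<plusminus>\<^sup>1\<close> in \<open>\<tau>\<^sub>r\<close>. For \<open>n = 2r + 1\<close> and
  \<open>i = r\<close> the image of the middle generator \<open>B\<^bsub>r+1\<^esub>\<close> involves two indices at once: moving \<open>\<dd>\<close> past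
  \<open>\<xx>\<close> at both of them produces quadratic terms that cancel (\<open>middle_sum\<close>).

  Both signs \<open>e\<close> are treated at once, because the relations of \<open>\<A>\<^sub>q\<close>
  are invariant under \<open>q \<mapsto> q\<^sup>-\<^sup>1\<close>, \<open>\<mm>\<^sub>k \<mapsto> \<mm>\<^sub>k\<^sup>-\<^sup>1\<close> (\<open>qweyl_ring_inverse\<close>). All of them are therefore proved
  for \<open>v = q\<^sup>e\<close> and \<open>m\<^sub>k = \<mm>\<^sub>k\<^sup>e\<close>.
\<close>

section \<open>Scalars and free algebras\<close>

text \<open>A set of scalars closed under the field operations is all of \<open>\<rat>(q)\<close> as soon as it contains \<open>\<rat>\<close>
  and \<open>q\<close>. The negatives come from multiplication by the constant \<open>-1\<close>.\<close>

lemma Qq_induct [case_names const qq add mult inverse]: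
  assumes const: "\<And>a. P (Qq_of_rat a)" and qq: "P qq"
    and add: "\<And>b c. P b \<Longrightarrow> P c \<Longrightarrow> P (b + c)"
    and mult: "\<And>b c. P b \<Longrightarrow> P c \<Longrightarrow> P (b * c)"
    and inverse: "\<And>c. P c \<Longrightarrow> c \<noteq> 0 \<Longrightarrow> P (inverse c)"
  shows "P c"
proof -
  have poly: "P (Fraction_Field.Fract p 1)" for p
  proof (induction p)
    case 0
    show ?case using const[of 0] by (simp add: Qq_of_rat_def)
  next
    case (pCons a p)
    have "pCons a p = [:a:] + [:0, 1:] * p" by simp
    then have "Fraction_Field.Fract (pCons a p) 1 = Qq_of_rat a + qq * Fraction_Field.Fract p 1"
      unfolding Qq_of_rat_def qq_def by simp
    then show ?case using add[OF const[of a] mult[OF qq pCons.IH]] by simp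
  qed
  show ?thesis
  proof (cases c)
    case (Fract a b)
    then have "c = Fraction_Field.Fract a 1 * inverse (Fraction_Field.Fract b 1)"
      "Fraction_Field.Fract b 1 \<noteq> 0"
      by (auto simp: Zero_fract_def eq_fract)
    then show ?thesis using mult[OF poly inverse[OF poly]] by simp
  qed
qed

lemma qq_nonzero: "qq \<noteq> 0"
  by (simp add: qq_def Zero_fract_def eq_fract)

lemma qq_square: "qq * qq \<noteq> 1"
  by (simp add: qq_def One_fract_def eq_fract one_pCons)

lemma scal_add: "scal (a + b) = scal a + scal b"
  by (simp add: scal_def single_add)

lemma scal_mult: "scal (a * b) = scal a * scal b"
  by (simp add: scal_def mult_single)

lemma scal_1: "scal 1 = 1"
  by (simp add: scal_def)

lemma poly_mapping_sum_monomials: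
  fixes p :: "'a \<Rightarrow>\<^sub>0 'b::comm_monoid_add"
  shows "(\<Sum>w\<in>Poly_Mapping.keys p. Poly_Mapping.single w (Poly_Mapping.lookup p w)) = p"
  by (intro poly_mapping_eqI) (auto simp: lookup_sum lookup_single when_def in_keys_iff)

lemma scal_commute: "scal c * p = p * scal c"
proof -
  have "scal c * (\<Sum>w\<in>S. Poly_Mapping.single w (f w)) = (\<Sum>w\<in>S. Poly_Mapping.single w (f w)) * scal c" for S f
    by (simp add: sum_distrib_left sum_distrib_right scal_def mult_single mult.commute)
  from this[of "Poly_Mapping.lookup p" "Poly_Mapping.keys p"] show ?thesis
    unfolding poly_mapping_sum_monomials .
qed

lemma single_Word_Cons:
  "Poly_Mapping.single (Word (g # l)) c = gen g * Poly_Mapping.single (Word l) c"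
  by (simp add: gen_def mult_single plus_word_def)

lemma free_ring_ops [simp]:
  "monoid.mult (free_ring X) = (*)" "monoid.one (free_ring X) = 1"
  "ring.zero (free_ring X) = 0" "ring.add (free_ring X) = (+)"
  by (simp_all add: free_ring_def)

lemma free_ring_closed [simp]:
  "p \<in> carrier (free_ring X) \<Longrightarrow> p' \<in> carrier (free_ring X) \<Longrightarrow> p + p' \<in> carrier (free_ring X)"
  "p \<in> carrier (free_ring X) \<Longrightarrow> p' \<in> carrier (free_ring X) \<Longrightarrow> p * p' \<in> carrier (free_ring X)"
  "0 \<in> carrier (free_ring X)" "1 \<in> carrier (free_ring X)"
  using ring.ring_simprules(1)[OF ring_free_ring[of X], of p p']
    ring.ring_simprules(5)[OF ring_free_ring[of X], of p p']
    ring.ring_simprules(2,6)[OF ring_free_ring[of X]]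
  by simp_all

lemma scal_closed [simp]: "scal c \<in> carrier (free_ring X)"
  by (simp add: free_ring_def scal_def zero_word_def)

lemma gen_closed [simp]: "gen g \<in> carrier (free_ring X) \<longleftrightarrow> g \<in> X"
  by (simp add: free_ring_def gen_def)

lemma free_ring_uminus [simp]: "p \<in> carrier (free_ring X) \<Longrightarrow> - p \<in> carrier (free_ring X)"
  by (simp add: free_ring_def)

lemma free_ring_minus [simp]:
  "p \<in> carrier (free_ring X) \<Longrightarrow> p' \<in> carrier (free_ring X) \<Longrightarrow> p - p' \<in> carrier (free_ring X)"
  using free_ring_closed(1)[of p X "- p'"] by simp

lemma free_ring_power [simp]:
  "p \<in> carrier (free_ring X) \<Longrightarrow> p ^ k \<in> carrier (free_ring X)"
  by (induction k) auto

lemma qbr_closed [simp]: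
  "p \<in> carrier (free_ring X) \<Longrightarrow> p' \<in> carrier (free_ring X) \<Longrightarrow> qbr k p p' \<in> carrier (free_ring X)"
  by (simp add: qbr_def)

section \<open>Algebras given by generators and relations\<close>

locale presentation =
  fixes P :: "'g pres"
  assumes relators_closed: "snd P \<subseteq> carrier (free_ring (fst P))"
begin

abbreviation "F \<equiv> free_ring (fst P)"
abbreviation "A \<equiv> palg P"
abbreviation "s c \<equiv> cls P (scal c)"

lemma ideal_rel: "ideal (rel_ideal P) F"
  unfolding rel_ideal_def by (rule ring.genideal_ideal[OF ring_free_ring relators_closed])

lemma ring_A: "ring A"
  unfolding palg_def by (rule ideal.quotient_is_ring[OF ideal_rel])

sublocale A: ring A by (rule ring_A)

lemma cls_hom: "cls P \<in> ring_hom F A"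
  unfolding palg_def using ideal.rcos_ring_hom[OF ideal_rel] by (simp add: cls_def[abs_def])

lemma cls_closed [simp]: "p \<in> carrier F \<Longrightarrow> cls P p \<in> carrier A"
  using ring_hom_closed[OF cls_hom] .

lemma cls_simps [simp]:
  "p \<in> carrier F \<Longrightarrow> p' \<in> carrier F \<Longrightarrow> cls P (p + p') = cls P p \<oplus>\<^bsub>A\<^esub> cls P p'"
  "p \<in> carrier F \<Longrightarrow> p' \<in> carrier F \<Longrightarrow> cls P (p * p') = cls P p \<otimes>\<^bsub>A\<^esub> cls P p'"
  "cls P 1 = \<one>\<^bsub>A\<^esub>" "cls P 0 = \<zero>\<^bsub>A\<^esub>"
  using ring_hom_add[OF cls_hom] ring_hom_mult[OF cls_hom] ring_hom_one[OF cls_hom]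
     ring_hom_zero[OF cls_hom ring_free_ring ring_A] by auto

lemma s_simps:
  "s (a + b) = s a \<oplus>\<^bsub>A\<^esub> s b" "s (a * b) = s a \<otimes>\<^bsub>A\<^esub> s b" "s 1 = \<one>\<^bsub>A\<^esub>" "s 0 = \<zero>\<^bsub>A\<^esub>"
  by (simp_all add: scal_add scal_mult scal_1) (simp add: scal_def)

text \<open>Negatives are written as multiples by the scalar \<open>-1\<close>, so that every element below is a sum of
  scalar multiples of monomials and subtraction never has to be normalised.\<close>

lemma cls_uminus [simp]: "p \<in> carrier F \<Longrightarrow> cls P (- p) = s (- 1) \<otimes>\<^bsub>A\<^esub> cls P p"
proof -
  assume p: "p \<in> carrier F"
  have "scal (- 1) * p = - p"
    by (simp add: scal_def single_uminus)
  then show ?thesis using p by (metis scal_closed cls_simps(2))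
qed

lemma cls_minus [simp]:
  "p \<in> carrier F \<Longrightarrow> p' \<in> carrier F \<Longrightarrow> cls P (p - p') = cls P p \<oplus>\<^bsub>A\<^esub> s (- 1) \<otimes>\<^bsub>A\<^esub> cls P p'"
  using cls_simps(1)[of p "- p'"] by simp

lemma carrier_A: "carrier A = cls P ` carrier F"
  by (auto simp: palg_def FactRing_def A_RCOSETS_def' cls_def)

lemma s_central: "u \<in> carrier A \<Longrightarrow> u \<otimes>\<^bsub>A\<^esub> s c = s c \<otimes>\<^bsub>A\<^esub> u"
  unfolding carrier_A by (auto simp flip: cls_simps simp: scal_commute)

lemma cls_eqI:
  assumes "p - p' \<in> snd P" "p \<in> carrier F" "p' \<in> carrier F"
  shows "cls P p = cls P p'"
proof -
  have "p - p' \<in> rel_ideal P"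
    using assms(1) ring.genideal_self[OF ring_free_ring relators_closed] by (auto simp: rel_ideal_def)
  then have "cls P (p - p') = \<zero>\<^bsub>A\<^esub>"
    using ring.a_rcos_zero[OF ring_free_ring ideal_rel] by (simp add: cls_def palg_def FactRing_def)
  moreover have "cls P ((p - p') + p') = cls P (p - p') \<oplus>\<^bsub>A\<^esub> cls P p'"
    using assms by (intro cls_simps(1)) simp_all
  ultimately have "cls P ((p - p') + p') = cls P p'"
    using assms by (simp only: A.l_zero cls_closed)
  then show ?thesis by (simp only: diff_add_cancel)
qed

text \<open>The generators generate: a subset closed under sums and products which contains the scalars and
  the generators is everything. Unlike a statement about homomorphisms, this form also serves
  anti-multiplicative and semilinear maps.\<close>

lemma palg_induct [consumes 1, case_names scal gen add mult]:
  assumes u: "u \<in> carrier A"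
    and scal: "\<And>c. Q (s c)" and gen: "\<And>g. g \<in> fst P \<Longrightarrow> Q (cls P (gen g))"
    and add: "\<And>a b. a \<in> carrier A \<Longrightarrow> b \<in> carrier A \<Longrightarrow> Q a \<Longrightarrow> Q b \<Longrightarrow> Q (a \<oplus>\<^bsub>A\<^esub> b)"
    and mult: "\<And>a b. a \<in> carrier A \<Longrightarrow> b \<in> carrier A \<Longrightarrow> Q a \<Longrightarrow> Q b \<Longrightarrow> Q (a \<otimes>\<^bsub>A\<^esub> b)"
  shows "Q u"
proof -
  have word: "Poly_Mapping.single (Word l) c \<in> carrier F \<and> Q (cls P (Poly_Mapping.single (Word l) c))"
    if "set l \<subseteq> fst P" for l c
    using that
  proof (induction l)
    case Nil
    have "Poly_Mapping.single (Word []) c = (scal c :: 'g freealg)" by (simp add: scal_def zero_word_def)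
    then show ?case by (simp add: scal)
  next
    case (Cons g l)
    then show ?case by (simp add: single_Word_Cons mult gen)
  qed
  obtain p where p: "p \<in> carrier F" "u = cls P p" using u carrier_A by auto
  have sum: "(\<Sum>w\<in>S. Poly_Mapping.single w (f w)) \<in> carrier F \<and> Q (cls P (\<Sum>w\<in>S. Poly_Mapping.single w (f w)))"
    if "finite S" "\<forall>w\<in>S. set (letters w) \<subseteq> fst P" for S f
    using that
  proof (induction S rule: finite_induct)
    case empty
    show ?case using scal[of 0] s_simps(4) by simp
  next
    case (insert w S)
    then show ?case using word[of "letters w" "f w"] by (simp add: add)
  qed
  have "\<forall>w\<in>Poly_Mapping.keys p. set (letters w) \<subseteq> fst P" using p(1) by (simp add: free_ring_def)
  then show ?thesis using sum[of "Poly_Mapping.keys p" "Poly_Mapping.lookup p"] p(2)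
    by (simp add: poly_mapping_sum_monomials)
qed

lemma cls_qbr [simp]:
  assumes "p \<in> carrier F" "p' \<in> carrier F"
  shows "cls P (qbr k p p') =
    cls P p \<otimes>\<^bsub>A\<^esub> cls P p' \<oplus>\<^bsub>A\<^esub> s (- (qq powi k)) \<otimes>\<^bsub>A\<^esub> (cls P p' \<otimes>\<^bsub>A\<^esub> cls P p)"
proof -
  have "s (- 1) \<otimes>\<^bsub>A\<^esub> (s c \<otimes>\<^bsub>A\<^esub> u) = s (- c) \<otimes>\<^bsub>A\<^esub> u" if "u \<in> carrier A" for c u
    using that s_simps(2)[of "- 1" c] by (simp add: A.m_assoc)
  then show ?thesis using assms by (simp add: qbr_def)
qed

end

locale presented_hom = P: presentation P + Q: presentation Q for P :: "'g pres" and Q :: "'h pres" +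
  fixes h
  assumes alg_hom: "alg_hom P Q h"
begin

lemma hom_simps [simp]:
  "u \<in> carrier (palg P) \<Longrightarrow> h u \<in> carrier (palg Q)"
  "u \<in> carrier (palg P) \<Longrightarrow> u' \<in> carrier (palg P) \<Longrightarrow>
     h (u \<oplus>\<^bsub>palg P\<^esub> u') = h u \<oplus>\<^bsub>palg Q\<^esub> h u'"
  "u \<in> carrier (palg P) \<Longrightarrow> u' \<in> carrier (palg P) \<Longrightarrow>
     h (u \<otimes>\<^bsub>palg P\<^esub> u') = h u \<otimes>\<^bsub>palg Q\<^esub> h u'"
  "h \<one>\<^bsub>palg P\<^esub> = \<one>\<^bsub>palg Q\<^esub>"
  "h (cls P (scal c)) = cls Q (scal c)"
  using alg_hom unfolding alg_hom_def
  by (simp_all add: ring_hom_closed[of h "palg P" "palg Q"] ring_hom_add[of h "palg P" "palg Q"]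
      ring_hom_mult[of h "palg P" "palg Q"] ring_hom_one[of h "palg P" "palg Q"])

end

section \<open>The q-Weyl relations in a ring\<close>

text \<open>The relations of the \<open>q\<close>-Weyl algebra, for elements of an arbitrary ring with a central field of
  scalars. In the application, \<open>v\<close> stands for \<open>q\<^sup>e\<close>, the element \<open>m i\<close> for \<open>\<mm>\<^sub>i\<^sup>e\<close>, and \<open>w i\<close> is the power of
  \<open>v\<close> (the first or the second) given by the weight of the index \<open>i\<close>.\<close>

locale qweyl_ring = ring R for R (structure) +
  fixes s :: "'k::field \<Rightarrow> 'a" and d x m mi :: "nat \<Rightarrow> 'a" and I :: "nat set"
    and w :: "nat \<Rightarrow> 'k" and v :: 'k
  assumes v: "v \<noteq> 0" "v * v \<noteq> 1" and w: "\<And>i. i \<in> I \<Longrightarrow> w i \<noteq> 0"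
    and s_closed [simp]: "\<And>c. s c \<in> carrier R"
    and s_add: "\<And>b c. s (b + c) = s b \<oplus> s c"
    and s_mult: "\<And>b c. s (b * c) = s b \<otimes> s c"
    and s_one: "s 1 = \<one>"
    and s_central: "\<And>u c. u \<in> carrier R \<Longrightarrow> u \<otimes> s c = s c \<otimes> u"
    and gen_closed [simp]: "\<And>i. i \<in> I \<Longrightarrow> d i \<in> carrier R" "\<And>i. i \<in> I \<Longrightarrow> x i \<in> carrier R"
      "\<And>i. i \<in> I \<Longrightarrow> m i \<in> carrier R" "\<And>i. i \<in> I \<Longrightarrow> mi i \<in> carrier R"
    and m_mi: "\<And>i. i \<in> I \<Longrightarrow> m i \<otimes> mi i = \<one>" and mi_m: "\<And>i. i \<in> I \<Longrightarrow> mi i \<otimes> m i = \<one>"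
    and d_m: "\<And>i. i \<in> I \<Longrightarrow> d i \<otimes> m i = s (w i) \<otimes> (m i \<otimes> d i)"
    and x_m: "\<And>i. i \<in> I \<Longrightarrow> x i \<otimes> m i = s (inverse (w i)) \<otimes> (m i \<otimes> x i)"
    and d_x: "\<And>i. i \<in> I \<Longrightarrow> d i \<otimes> x i = s (inverse (v - inverse v)) \<otimes>
        (s (w i) \<otimes> m i \<oplus> s (- inverse (w i)) \<otimes> mi i)"
    and x_d: "\<And>i. i \<in> I \<Longrightarrow> x i \<otimes> d i = s (inverse (v - inverse v)) \<otimes> (m i \<oplus> s (- 1) \<otimes> mi i)"
    and mm: "\<And>i j. i \<in> I \<Longrightarrow> j \<in> I \<Longrightarrow> m i \<otimes> m j = m j \<otimes> m i"
    and dd: "\<And>i j. i \<in> I \<Longrightarrow> j \<in> I \<Longrightarrow> d i \<otimes> d j = d j \<otimes> d i"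
    and xx: "\<And>i j. i \<in> I \<Longrightarrow> j \<in> I \<Longrightarrow> x i \<otimes> x j = x j \<otimes> x i"
    and dm: "\<And>i j. i \<in> I \<Longrightarrow> j \<in> I \<Longrightarrow> i \<noteq> j \<Longrightarrow> d i \<otimes> m j = m j \<otimes> d i"
    and xm: "\<And>i j. i \<in> I \<Longrightarrow> j \<in> I \<Longrightarrow> i \<noteq> j \<Longrightarrow> x i \<otimes> m j = m j \<otimes> x i"
    and dx: "\<And>i j. i \<in> I \<Longrightarrow> j \<in> I \<Longrightarrow> i \<noteq> j \<Longrightarrow> d i \<otimes> x j = x j \<otimes> d i"
begin

text \<open>Conjugating a \<open>q\<close>-commutation relation with \<open>m i\<close> by its inverse inverts the scalar.\<close>

lemma commute_mi:
  assumes "a \<in> carrier R" "i \<in> I" "c \<noteq> 0" "a \<otimes> m i = s c \<otimes> (m i \<otimes> a)"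
  shows "a \<otimes> mi i = s (inverse c) \<otimes> (mi i \<otimes> a)"
proof -
  have "mi i \<otimes> (a \<otimes> m i) \<otimes> mi i = s c \<otimes> (a \<otimes> mi i)"
    unfolding assms(4) using assms(1,2)
    by (simp add: m_assoc s_central[of "mi i"] flip: m_assoc[of "mi i" "s c"])
       (simp add: mi_m flip: m_assoc[of "mi i" "m i"])
  moreover have "mi i \<otimes> (a \<otimes> m i) \<otimes> mi i = mi i \<otimes> a"
    using assms(1,2) by (simp add: m_assoc m_mi)
  ultimately have *: "mi i \<otimes> a = s c \<otimes> (a \<otimes> mi i)" by simp
  have "s (inverse c) \<otimes> (mi i \<otimes> a) = s (inverse c * c) \<otimes> (a \<otimes> mi i)"
    unfolding * s_mult using assms(1,2) by (simp add: m_assoc)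
  then show ?thesis using assms(1-3) by (simp add: s_one)
qed

lemma commute_mi_1:
  assumes "a \<in> carrier R" "i \<in> I" "a \<otimes> m i = m i \<otimes> a"
  shows "a \<otimes> mi i = mi i \<otimes> a"
  using commute_mi[of a i 1] assms by (simp add: s_one)

lemma d_mi: "i \<in> I \<Longrightarrow> d i \<otimes> mi i = s (inverse (w i)) \<otimes> (mi i \<otimes> d i)"
  by (intro commute_mi) (auto simp: d_m w)

lemma x_mi: "i \<in> I \<Longrightarrow> x i \<otimes> mi i = s (w i) \<otimes> (mi i \<otimes> x i)"
  using commute_mi[of "x i" i "inverse (w i)"] by (auto simp: x_m w)

lemma commute_ne:
  assumes "i \<in> I" "j \<in> I" "i \<noteq> j" "a \<in> {d i, x i, m i, mi i}" "b \<in> {d j, x j, m j, mi j}"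
  shows "a \<otimes> b = b \<otimes> a"
proof -
  have *: "a \<otimes> b = b \<otimes> a" if "a \<in> {d i, x i, m i}" "b \<in> {d j, x j, m j}" "i \<in> I" "j \<in> I" "i \<noteq> j" for a b i j
    using that mm dd xx dm xm dx dm[symmetric, of j i] xm[symmetric, of j i] dx[symmetric, of j i] by auto
  have **: "a \<otimes> b = b \<otimes> a" if "a \<in> {d i, x i, m i}" "b \<in> {d j, x j, m j, mi j}" "i \<in> I" "j \<in> I" "i \<noteq> j" for a b i j
  proof (cases "b = mi j")
    case True
    then show ?thesis using *[of a i "m j" j] commute_mi_1[of a j] that by auto
  next
    case False
    then show ?thesis using *[of a i b j] that by auto
  qed
  show ?thesis
  proof (cases "a = mi i")
    case True
    then show ?thesis using commute_mi_1[of b i] **[of "m i" i b j] assms by auto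
  next
    case False
    then show ?thesis using **[of a i b j] assms by auto
  qed
qed

text \<open>Oriented for rewriting: a factor with smaller index moves to the left. Together with the rules
  for equal indices, which move \<open>m\<close> and \<open>mi\<close> to the left of \<open>x\<close> and \<open>d\<close>, this sorts every monomial.
  Each rule also comes with a trailing factor, as products are nested to the right.\<close>

lemma commute_sort:
  assumes "i < j" "i \<in> I" "j \<in> I"
  shows "d j \<otimes> d i = d i \<otimes> d j" "d j \<otimes> x i = x i \<otimes> d j"
    "d j \<otimes> m i = m i \<otimes> d j" "d j \<otimes> mi i = mi i \<otimes> d j"
    "x j \<otimes> d i = d i \<otimes> x j" "x j \<otimes> x i = x i \<otimes> x j"
    "x j \<otimes> m i = m i \<otimes> x j" "x j \<otimes> mi i = mi i \<otimes> x j"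
    "m j \<otimes> d i = d i \<otimes> m j" "m j \<otimes> x i = x i \<otimes> m j"
    "m j \<otimes> m i = m i \<otimes> m j" "m j \<otimes> mi i = mi i \<otimes> m j"
    "mi j \<otimes> d i = d i \<otimes> mi j" "mi j \<otimes> x i = x i \<otimes> mi j"
    "mi j \<otimes> m i = m i \<otimes> mi j" "mi j \<otimes> mi i = mi i \<otimes> mi j"
  using assms by (auto intro!: commute_ne[of j i])

lemma left_commute:
  assumes "a \<otimes> b = b \<otimes> a" "a \<in> carrier R" "b \<in> carrier R" "y \<in> carrier R"
  shows "a \<otimes> (b \<otimes> y) = b \<otimes> (a \<otimes> y)"
  using assms by (simp flip: m_assoc)

lemma left_commute_sort:
  assumes "i < j" "i \<in> I" "j \<in> I" "y \<in> carrier R"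
  shows "d j \<otimes> (d i \<otimes> y) = d i \<otimes> (d j \<otimes> y)" "d j \<otimes> (x i \<otimes> y) = x i \<otimes> (d j \<otimes> y)"
    "d j \<otimes> (m i \<otimes> y) = m i \<otimes> (d j \<otimes> y)" "d j \<otimes> (mi i \<otimes> y) = mi i \<otimes> (d j \<otimes> y)"
    "x j \<otimes> (d i \<otimes> y) = d i \<otimes> (x j \<otimes> y)" "x j \<otimes> (x i \<otimes> y) = x i \<otimes> (x j \<otimes> y)"
    "x j \<otimes> (m i \<otimes> y) = m i \<otimes> (x j \<otimes> y)" "x j \<otimes> (mi i \<otimes> y) = mi i \<otimes> (x j \<otimes> y)"
    "m j \<otimes> (d i \<otimes> y) = d i \<otimes> (m j \<otimes> y)" "m j \<otimes> (x i \<otimes> y) = x i \<otimes> (m j \<otimes> y)"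
    "m j \<otimes> (m i \<otimes> y) = m i \<otimes> (m j \<otimes> y)" "m j \<otimes> (mi i \<otimes> y) = mi i \<otimes> (m j \<otimes> y)"
    "mi j \<otimes> (d i \<otimes> y) = d i \<otimes> (mi j \<otimes> y)" "mi j \<otimes> (x i \<otimes> y) = x i \<otimes> (mi j \<otimes> y)"
    "mi j \<otimes> (m i \<otimes> y) = m i \<otimes> (mi j \<otimes> y)" "mi j \<otimes> (mi i \<otimes> y) = mi i \<otimes> (mi j \<otimes> y)"
  using assms by (auto intro!: left_commute commute_ne[of j i])

lemma q_left_commute:
  assumes "a \<otimes> b = s c \<otimes> (b \<otimes> a)" "a \<in> carrier R" "b \<in> carrier R" "y \<in> carrier R"
  shows "a \<otimes> (b \<otimes> y) = s c \<otimes> (b \<otimes> (a \<otimes> y))"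
proof -
  have "a \<otimes> (b \<otimes> y) = s c \<otimes> (b \<otimes> a) \<otimes> y" using assms by (simp flip: m_assoc)
  then show ?thesis using assms by (simp add: m_assoc)
qed

lemma same_index:
  assumes "i \<in> I" "y \<in> carrier R"
  shows "d i \<otimes> (m i \<otimes> y) = s (w i) \<otimes> (m i \<otimes> (d i \<otimes> y))"
    "x i \<otimes> (m i \<otimes> y) = s (inverse (w i)) \<otimes> (m i \<otimes> (x i \<otimes> y))"
    "d i \<otimes> (mi i \<otimes> y) = s (inverse (w i)) \<otimes> (mi i \<otimes> (d i \<otimes> y))"
    "x i \<otimes> (mi i \<otimes> y) = s (w i) \<otimes> (mi i \<otimes> (x i \<otimes> y))"
    "m i \<otimes> (mi i \<otimes> y) = y" "mi i \<otimes> (m i \<otimes> y) = y"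
  using assms q_left_commute d_m x_m d_mi x_mi m_mi mi_m by (auto simp flip: m_assoc[of "m i"] m_assoc[of "mi i"])

lemma scalars_left:
  assumes "y \<in> carrier R"
  shows "s b \<otimes> s c = s (b * c)" "s b \<otimes> (s c \<otimes> y) = s (b * c) \<otimes> y" "s 1 \<otimes> y = y"
  using assms by (auto simp: s_mult s_one m_assoc)

lemma gen_scalar:
  assumes "i \<in> I"
  shows "d i \<otimes> s c = s c \<otimes> d i" "x i \<otimes> s c = s c \<otimes> x i" "m i \<otimes> s c = s c \<otimes> m i"
    "mi i \<otimes> s c = s c \<otimes> mi i"
  using assms by (auto intro: s_central)

lemma gen_scalar_left:
  assumes "i \<in> I" "y \<in> carrier R"
  shows "d i \<otimes> (s c \<otimes> y) = s c \<otimes> (d i \<otimes> y)" "x i \<otimes> (s c \<otimes> y) = s c \<otimes> (x i \<otimes> y)"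
    "m i \<otimes> (s c \<otimes> y) = s c \<otimes> (m i \<otimes> y)" "mi i \<otimes> (s c \<otimes> y) = s c \<otimes> (mi i \<otimes> y)"
  using assms by (auto intro!: left_commute s_central)

text \<open>These rules bring a monomial into the form \<open>s c \<otimes> \<dots>\<close> with indices ascending and, for each
  index, \<open>m\<close> and \<open>mi\<close> in front. They leave the order of \<open>x i\<close> and \<open>d i\<close> alone.\<close>

lemmas normal_form = m_assoc commute_sort left_commute_sort d_m x_m d_mi x_mi m_mi mi_m same_index
  scalars_left gen_scalar gen_scalar_left s_one

text \<open>The \<open>q\<close>-commutator with parameter \<open>c\<close>; with \<open>c\<close> a power of \<open>q\<close> it is the class of \<^const>\<open>qbr\<close>.\<close>

definition brk :: "'k \<Rightarrow> 'a \<Rightarrow> 'a \<Rightarrow> 'a" where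
  "brk c a b = a \<otimes> b \<oplus> s (- c) \<otimes> (b \<otimes> a)"

lemma add_scaled:
  assumes "y \<in> carrier R"
  shows "s b \<otimes> y \<oplus> s c \<otimes> y = s (b + c) \<otimes> y"
  using assms by (simp add: s_add l_distr)

lemma s_0: "s 0 = \<zero>"
  using s_add[of 0 0] by (metis add_0 s_closed r_neg1 l_neg)

lemma add_scaled_pairs:
  assumes "y \<in> carrier R" "z \<in> carrier R"
  shows "(s a \<otimes> y \<oplus> s b \<otimes> z) \<oplus> (s a' \<otimes> y \<oplus> s b' \<otimes> z) = s (a + a') \<otimes> y \<oplus> s (b + b') \<otimes> z"
  using assms by (simp add: s_add l_distr a_ac)

text \<open>The shape of both \<open>x i \<otimes> d i\<close> and \<open>d i \<otimes> x i\<close>: combinations of the same two elements \<open>p = m i\<close> and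
  \<open>p' = mi i\<close> with a common factor \<open>k\<close>.\<close>

lemma brk_of_combinations:
  assumes y: "y \<in> carrier R" and z: "z \<in> carrier R"
    and y2: "y = s k \<otimes> (s a \<otimes> p \<oplus> s b \<otimes> p')"
    and z2: "z = s k \<otimes> (s a' \<otimes> p \<oplus> s b' \<otimes> p')"
    and p: "p \<in> carrier R" "p' \<in> carrier R"
  shows "y \<oplus> s (- c) \<otimes> z = s (k * (a - c * a')) \<otimes> p \<oplus> s (k * (b - c * b')) \<otimes> p'"
proof -
  have "y \<oplus> s (- c) \<otimes> z = (s (k * a) \<otimes> p \<oplus> s (k * b) \<otimes> p') \<oplus> (s (- c * k * a') \<otimes> p \<oplus> s (- c * k * b') \<otimes> p')"
    unfolding y2 z2 using p by (simp add: r_distr scalars_left ac_simps)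
  also have "\<dots> = s (k * (a - c * a')) \<otimes> p \<oplus> s (k * (b - c * b')) \<otimes> p'"
    unfolding add_scaled_pairs[OF p] by (simp add: algebra_simps)
  finally show ?thesis .
qed

lemma brk_x_d:
  assumes "i \<in> I"
  shows "brk c (x i) (d i) = s (inverse (v - inverse v) * (1 - c * w i)) \<otimes> m i
      \<oplus> s (inverse (v - inverse v) * (c * inverse (w i) - 1)) \<otimes> mi i"
  unfolding brk_def
  using brk_of_combinations[of "x i \<otimes> d i" "d i \<otimes> x i" "inverse (v - inverse v)" 1 "m i" "- 1" "mi i" "w i" "- inverse (w i)" c] assms
  by (simp add: x_d d_x s_one)

lemma brk_d_x:
  assumes "i \<in> I"
  shows "brk c (d i) (x i) = s (inverse (v - inverse v) * (w i - c)) \<otimes> m i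
      \<oplus> s (inverse (v - inverse v) * (c - inverse (w i))) \<otimes> mi i"
  unfolding brk_def
  using brk_of_combinations[of "d i \<otimes> x i" "x i \<otimes> d i" "inverse (v - inverse v)" "w i" "m i" "- inverse (w i)" "mi i" 1 "- 1" c] assms
  by (simp add: x_d d_x s_one algebra_simps)

lemma v_minus: "v - inverse v \<noteq> 0"
  using v by (metis diff_eq_diff_eq diff_self left_inverse mult.commute)

text \<open>For weight one, \<open>1 - c \<cdot> w i\<close> or \<open>c / w i - 1\<close> vanishes when \<open>c\<close> is \<open>v\<^sup>-\<^sup>1\<close> or \<open>v\<close>, and likewise in the other
  order. What survives is the single factor \<open>m i\<close> or \<open>mi i\<close> in the values of the automorphisms.\<close>

lemma brk_weight1:
  assumes "i \<in> I" "w i = v"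
  shows "brk v (x i) (d i) = s (- v) \<otimes> m i" "brk (inverse v) (x i) (d i) = s (- inverse v) \<otimes> mi i"
    "brk v (d i) (x i) = mi i" "brk (inverse v) (d i) (x i) = m i"
proof -
  have *: "inverse (v - inverse v) * (1 - v * v) = - v" "inverse (v - inverse v) * (inverse v * inverse v - 1) = - inverse v"
    using v_minus v by (simp_all add: field_simps)
  show "brk v (x i) (d i) = s (- v) \<otimes> m i" "brk (inverse v) (x i) (d i) = s (- inverse v) \<otimes> mi i"
    "brk v (d i) (x i) = mi i" "brk (inverse v) (d i) (x i) = m i"
    unfolding brk_x_d[OF assms(1)] brk_d_x[OF assms(1)] assms(2) using assms(1) v v_minus
    by (simp_all add: * s_0 s_one)
qed

text \<open>For weight two neither coefficient vanishes at the parameter \<open>1\<close>, and \<open>v - v\<^sup>-\<^sup>1\<close> divides both.\<close>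

lemma brk_weight2:
  assumes "i \<in> I" "w i = v * v"
  shows "brk 1 (x i) (d i) = s (- v) \<otimes> m i \<oplus> s (- inverse v) \<otimes> mi i"
    "brk 1 (d i) (x i) = s v \<otimes> m i \<oplus> s (inverse v) \<otimes> mi i"
proof -
  have *: "inverse (v - inverse v) * (1 - v * v) = - v" "inverse (v - inverse v) * (v * v - 1) = v"
     "inverse (v - inverse v) * (inverse (v * v) - 1) = - inverse v"
     "inverse (v - inverse v) * (1 - inverse (v * v)) = inverse v"
    using v_minus v by (simp_all add: field_simps)
  show "brk 1 (x i) (d i) = s (- v) \<otimes> m i \<oplus> s (- inverse v) \<otimes> mi i"
    "brk 1 (d i) (x i) = s v \<otimes> m i \<oplus> s (inverse v) \<otimes> mi i"
    unfolding brk_x_d[OF assms(1)] brk_d_x[OF assms(1)] assms(2) mult_1 by (simp_all only: *)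
qed

text \<open>Pulling common outer factors out of a \<open>q\<close>-commutator. The parameter may change from \<open>c\<close> to \<open>c'\<close>,
  because sorting \<open>b \<otimes> a\<close> can produce a power of \<open>q\<close> that sorting \<open>a \<otimes> b\<close> does not.\<close>

lemma brk_factor:
  assumes "a \<otimes> b = p \<otimes> ((y \<otimes> z) \<otimes> t)" "s (- c) \<otimes> (b \<otimes> a) = s (- c') \<otimes> (p \<otimes> ((z \<otimes> y) \<otimes> t))"
    and "p \<in> carrier R" "y \<in> carrier R" "z \<in> carrier R" "t \<in> carrier R"
  shows "brk c a b = p \<otimes> (brk c' y z \<otimes> t)"
  unfolding brk_def assms(1,2)
  using assms(3-) by (simp add: l_distr r_distr m_assoc left_commute[OF s_central])

text \<open>The scalar \<open>1 / (v - v\<^sup>-\<^sup>1)\<close> changes sign under \<open>v \<mapsto> v\<^sup>-\<^sup>1\<close>, and so does the combination of \<open>m i\<close> and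
  \<open>mi i\<close> next to it when these two elements are exchanged.\<close>

lemma qweyl_ring_inverse: "qweyl_ring R s d x mi m I (\<lambda>i. inverse (w i)) (inverse v)"
proof
  fix i j
  have k: "inverse (inverse v - inverse (inverse v)) = - inverse (v - inverse v)"
    by (simp flip: inverse_minus_eq)
  have neg: "s (- b) \<otimes> (s c \<otimes> y \<oplus> s c' \<otimes> z) = s b \<otimes> (s (- c') \<otimes> z \<oplus> s (- c) \<otimes> y)"
    if "y \<in> carrier R" "z \<in> carrier R" for b c c' y z
    using that by (simp add: r_distr scalars_left a_comm)
  show "inverse v \<noteq> 0" "inverse v * inverse v \<noteq> 1"
    using v by (auto simp flip: inverse_mult_distrib)
  assume i: "i \<in> I"
  show "inverse (w i) \<noteq> 0" using w i by simp
  show "d i \<otimes> mi i = s (inverse (w i)) \<otimes> (mi i \<otimes> d i)" using i by (rule d_mi)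
  show "x i \<otimes> mi i = s (inverse (inverse (w i))) \<otimes> (mi i \<otimes> x i)" using x_mi i by simp
  show "d i \<otimes> x i = s (inverse (inverse v - inverse (inverse v))) \<otimes>
         (s (inverse (w i)) \<otimes> mi i \<oplus> s (- inverse (inverse (w i))) \<otimes> m i)"
    unfolding k using i neg[of "mi i" "m i"] by (simp add: d_x)
  show "x i \<otimes> d i = s (inverse (inverse v - inverse (inverse v))) \<otimes> (mi i \<oplus> s (- 1) \<otimes> m i)"
    unfolding k using i neg[of "mi i" "m i" _ 1 "- 1"] by (simp add: x_d scalars_left)
  assume j: "j \<in> I"
  show "mi i \<otimes> mi j = mi j \<otimes> mi i"
    using commute_ne[of i j "mi i" "mi j"] i j by (cases "i = j") auto
  assume ij: "i \<noteq> j"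
  show "d i \<otimes> mi j = mi j \<otimes> d i" "x i \<otimes> mi j = mi j \<otimes> x i"
    using commute_ne[of i j] i j ij by auto
qed (assumption | rule s_closed gen_closed s_add s_mult s_one s_central m_mi mi_m dd xx dx)+

section \<open>Images of the generators as identities in the q-Weyl algebra\<close>

lemma cancel_scaled:
  assumes "a \<in> carrier R" "y \<in> carrier R"
  shows "b + c = 0 \<Longrightarrow> a \<oplus> s b \<otimes> y \<oplus> s c \<otimes> y = a"
    "b + c = 0 \<Longrightarrow> s b \<otimes> y \<oplus> a \<oplus> s c \<otimes> y = a"
    "a \<oplus> y \<oplus> s (- 1) \<otimes> y = a" "y \<oplus> a \<oplus> s (- 1) \<otimes> y = a"
proof -
  have *: "a \<oplus> s b \<otimes> y \<oplus> s c \<otimes> y = a" if "b + c = 0" for b c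
    using assms that by (simp add: a_assoc add_scaled s_0)
  then show "b + c = 0 \<Longrightarrow> a \<oplus> s b \<otimes> y \<oplus> s c \<otimes> y = a"
    "b + c = 0 \<Longrightarrow> s b \<otimes> y \<oplus> a \<oplus> s c \<otimes> y = a"
    using assms by (simp_all add: a_comm[of _ a])
  show "a \<oplus> y \<oplus> s (- 1) \<otimes> y = a" "y \<oplus> a \<oplus> s (- 1) \<otimes> y = a"
    using *[of 1 "- 1"] assms by (simp_all add: s_one a_comm[of _ a])
qed

lemma v_cancel: "v * (inverse v * c) = c" "inverse v * (v * c) = c"
  using v by (simp_all flip: mult.assoc)

text \<open>In the identities about \<open>T'\<close> and \<open>T''\<close> of this part, the left-hand side is the product of the values of \<open>T'\<^sub>i\<close> or \<open>T''\<^sub>i\<close> at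
  the two factors of \<open>\<phi>(B\<^sub>j)\<close>, and the right-hand side is \<open>\<phi>\<close> applied to the value of \<open>\<tau>'\<^sub>i\<close> or \<open>\<tau>''\<^sub>i\<close> at
  \<open>B\<^sub>j\<close>. The suffix \<open>rho\<close> marks the mirrored generator \<open>B\<^bsub>\<rho>(j)\<^esub>\<close>; \<open>next\<close> and \<open>prev\<close> mark \<open>j = i + 1\<close> and
  \<open>j = i - 1\<close>. The two indices \<open>i\<close> and \<open>i + 1\<close> that \<open>T\<^sub>i\<close> moves have weight one for \<open>i < N\<close>, while the
  outer index of a neighbouring \<open>B\<^sub>j\<close> may have any weight.\<close>

context
  fixes i :: nat
  assumes I: "i \<in> I" "Suc i \<in> I" and wt: "w i = v" "w (Suc i) = v"
begin

lemma T'_B: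
  "(s (- 1) \<otimes> (s v \<otimes> m (Suc i) \<otimes> x i)) \<otimes> (mi i \<otimes> d (Suc i)) =
    s (- 1) \<otimes> ((x i \<otimes> d (Suc i)) \<otimes> (m (Suc i) \<otimes> mi i))"
  using I wt v by (simp add: normal_form)

lemma T'_B_rho:
  "(m i \<otimes> x (Suc i)) \<otimes> (s (- 1) \<otimes> (s (inverse v) \<otimes> mi (Suc i) \<otimes> d i)) =
    s (- 1) \<otimes> ((m i \<otimes> mi (Suc i)) \<otimes> (x (Suc i) \<otimes> d i))"
  using I wt v by (simp add: normal_form)

lemma T''_B:
  "(mi (Suc i) \<otimes> x i) \<otimes> (s (- 1) \<otimes> (s v \<otimes> m i \<otimes> d (Suc i))) =
    s (- 1) \<otimes> ((m i \<otimes> mi (Suc i)) \<otimes> (x i \<otimes> d (Suc i)))"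
  using I wt v by (simp add: normal_form)

lemma T''_B_rho:
  "(s (- 1) \<otimes> (s (inverse v) \<otimes> mi i \<otimes> x (Suc i))) \<otimes> (m (Suc i) \<otimes> d i) =
    s (- 1) \<otimes> ((x (Suc i) \<otimes> d i) \<otimes> (m (Suc i) \<otimes> mi i))"
  using I wt v by (simp add: normal_form)

lemma T'_B_next:
  assumes "Suc (Suc i) \<in> I"
  shows "x (Suc (Suc i)) \<otimes> (s (- 1) \<otimes> (s (inverse v) \<otimes> mi (Suc i) \<otimes> d i)) =
    brk (inverse v) (x (Suc i) \<otimes> d i) (x (Suc (Suc i)) \<otimes> d (Suc i))"
  using I wt v assms
  by (subst brk_factor[of _ _ "d i" "x (Suc i)" "d (Suc i)" "x (Suc (Suc i))" _ "inverse v"])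
     (simp_all add: normal_form brk_weight1)

lemma T'_B_rho_next:
  assumes "Suc (Suc i) \<in> I"
  shows "(s (- 1) \<otimes> (s v \<otimes> m (Suc i) \<otimes> x i)) \<otimes> d (Suc (Suc i)) =
    brk v (x (Suc i) \<otimes> d (Suc (Suc i))) (x i \<otimes> d (Suc i))"
  using I wt v assms
  by (subst brk_factor[of _ _ "x i" "x (Suc i)" "d (Suc i)" "d (Suc (Suc i))" _ v])
     (simp_all add: normal_form brk_weight1)

lemma T''_B_next:
  assumes "Suc (Suc i) \<in> I"
  shows "x (Suc (Suc i)) \<otimes> (m (Suc i) \<otimes> d i) =
    brk (inverse v) (x (Suc (Suc i)) \<otimes> d (Suc i)) (x (Suc i) \<otimes> d i)"
  using I wt v assms
  by (subst brk_factor[of _ _ "d i" "d (Suc i)" "x (Suc i)" "x (Suc (Suc i))" _ "inverse v"])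
     (simp_all add: normal_form brk_weight1)

lemma T''_B_rho_next:
  assumes "Suc (Suc i) \<in> I"
  shows "(mi (Suc i) \<otimes> x i) \<otimes> d (Suc (Suc i)) =
    brk v (x i \<otimes> d (Suc i)) (x (Suc i) \<otimes> d (Suc (Suc i)))"
  using I wt v assms
  by (subst brk_factor[of _ _ "x i" "d (Suc i)" "x (Suc i)" "d (Suc (Suc i))" _ v])
     (simp_all add: normal_form brk_weight1)

text \<open>Write \<open>X = x\<^sub>i d\<^sub>i\<close> and \<open>Y = x\<^sub>i\<^sub>+\<^sub>1 d\<^sub>i\<^sub>+\<^sub>1\<close>, which commute. Replacing \<open>d x\<close> by \<open>v x d + m\<^sup>-\<^sup>1\<close> at both indices,
  the first two summands become \<open>-m\<^sub>i\<^sub>+\<^sub>1 (v X + m\<^sub>i\<^sup>-\<^sup>1) Y\<close> and \<open>m\<^sub>i\<^sub>+\<^sub>1 X (v Y + m\<^sub>i\<^sub>+\<^sub>1\<^sup>-\<^sup>1)\<close>. The terms with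
  \<open>X Y\<close> cancel each other, and the term with \<open>Y\<close> cancels the third summand.\<close>

lemma middle_sum:
  "(s (- 1) \<otimes> (d i \<otimes> (x i \<otimes> (m (Suc i) \<otimes> (x (Suc i) \<otimes> d (Suc i))))) \<oplus>
     x i \<otimes> (d i \<otimes> (m (Suc i) \<otimes> (d (Suc i) \<otimes> x (Suc i))))) \<oplus>
    (x (Suc i) \<otimes> d (Suc i)) \<otimes> (m (Suc i) \<otimes> mi i) = x i \<otimes> d i"
proof -
  define X where "X = x i \<otimes> d i"
  define Y where "Y = x (Suc i) \<otimes> d (Suc i)"
  let ?m = "m (Suc i)"
  have cl [simp]: "X \<in> carrier R" "Y \<in> carrier R" using I by (auto simp: X_def Y_def)
  have dx: "d j \<otimes> x j = s v \<otimes> (x j \<otimes> d j) \<oplus> mi j" if "j \<in> I" "w j = v" for j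
  proof -
    have "mi j = d j \<otimes> x j \<oplus> s (- v) \<otimes> (x j \<otimes> d j)"
      using brk_weight1(3)[OF that] by (simp add: brk_def)
    then show ?thesis
      using that(1) cancel_scaled(1)[of "d j \<otimes> x j" "x j \<otimes> d j" "- v" v] by (simp add: a_comm)
  qed
  have "d i \<otimes> (x i \<otimes> (?m \<otimes> (x (Suc i) \<otimes> d (Suc i)))) = ?m \<otimes> ((d i \<otimes> x i) \<otimes> Y)"
    using I by (simp add: Y_def normal_form)
  also have "\<dots> = s v \<otimes> (?m \<otimes> (X \<otimes> Y)) \<oplus> ?m \<otimes> (mi i \<otimes> Y)"
    using I by (simp add: dx wt r_distr l_distr m_assoc gen_scalar_left flip: X_def)
  finally have 1: "d i \<otimes> (x i \<otimes> (?m \<otimes> (x (Suc i) \<otimes> d (Suc i)))) = s v \<otimes> (?m \<otimes> (X \<otimes> Y)) \<oplus> ?m \<otimes> (mi i \<otimes> Y)" .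
  have "x i \<otimes> (d i \<otimes> (?m \<otimes> (d (Suc i) \<otimes> x (Suc i)))) = ?m \<otimes> (X \<otimes> (d (Suc i) \<otimes> x (Suc i)))"
    using I by (simp add: X_def normal_form)
  also have "\<dots> = s v \<otimes> (?m \<otimes> (X \<otimes> Y)) \<oplus> ?m \<otimes> (X \<otimes> mi (Suc i))"
    using I by (simp add: dx wt r_distr l_distr m_assoc gen_scalar_left left_commute[OF s_central] flip: Y_def)
  also have "?m \<otimes> (X \<otimes> mi (Suc i)) = X"
    using I by (simp add: X_def normal_form)
  finally have 2: "x i \<otimes> (d i \<otimes> (?m \<otimes> (d (Suc i) \<otimes> x (Suc i)))) = s v \<otimes> (?m \<otimes> (X \<otimes> Y)) \<oplus> X" .
  have 3: "Y \<otimes> (?m \<otimes> mi i) = ?m \<otimes> (mi i \<otimes> Y)"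
    using I wt v by (simp add: Y_def normal_form)
  define Z where "Z = s v \<otimes> (?m \<otimes> (X \<otimes> Y))"
  define W where "W = ?m \<otimes> (mi i \<otimes> Y)"
  have cl' [simp]: "Z \<in> carrier R" "W \<in> carrier R" using I by (auto simp: Z_def W_def)
  have minus: "s (- 1) \<otimes> y = \<ominus> y" if "y \<in> carrier R" for y
    using that add_scaled[of y "- 1" 1] by (simp add: s_one s_0 minus_equality)
  have "(s (- 1) \<otimes> (Z \<oplus> W) \<oplus> (Z \<oplus> X)) \<oplus> W = X"
    using r_neg1[of "Z \<oplus> W" X] by (simp add: minus a_ac)
  then show ?thesis unfolding 1 2
    unfolding X_def[symmetric] Y_def[symmetric] 3 Z_def[symmetric] W_def[symmetric] .
qed

text \<open>The middle generator for \<open>n = 2r + 1\<close> and \<open>i = r\<close>. The inner commutator has rank one; the outer one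
  is the two-index sum above, for \<open>\<tau>'\<close> as well as for \<open>\<tau>''\<close>.\<close>

lemma T'_B_middle:
  "(s (- 1) \<otimes> (s v \<otimes> m (Suc i) \<otimes> x i)) \<otimes> (s (- 1) \<otimes> (s (inverse v) \<otimes> mi (Suc i) \<otimes> d i)) =
    brk (inverse v) (x (Suc i) \<otimes> d i) (brk v (x (Suc i) \<otimes> d (Suc i)) (x i \<otimes> d (Suc i)))
    \<oplus> (x (Suc i) \<otimes> d (Suc i)) \<otimes> (m (Suc i) \<otimes> mi i)"
proof -
  have inner: "brk v (x (Suc i) \<otimes> d (Suc i)) (x i \<otimes> d (Suc i)) =
      s (- v) \<otimes> (x i \<otimes> (m (Suc i) \<otimes> d (Suc i)))"
    using I wt v
    by (subst brk_factor[of _ _ "x i" "x (Suc i)" "d (Suc i)" "d (Suc i)" _ v])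
       (simp_all add: normal_form brk_weight1)
  have outer: "brk (inverse v) (x (Suc i) \<otimes> d i) (s (- v) \<otimes> (x i \<otimes> (m (Suc i) \<otimes> d (Suc i)))) =
     s (- 1) \<otimes> (d i \<otimes> (x i \<otimes> (m (Suc i) \<otimes> (x (Suc i) \<otimes> d (Suc i))))) \<oplus>
     x i \<otimes> (d i \<otimes> (m (Suc i) \<otimes> (d (Suc i) \<otimes> x (Suc i))))"
    using I wt v by (simp add: brk_def normal_form)
  show ?thesis unfolding inner outer middle_sum using I wt v by (simp add: normal_form)
qed

lemma T''_B_middle:
  "(mi (Suc i) \<otimes> x i) \<otimes> (m (Suc i) \<otimes> d i) =
    brk (inverse v) (brk v (x (Suc i) \<otimes> d i) (x (Suc i) \<otimes> d (Suc i))) (x i \<otimes> d (Suc i))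
    \<oplus> (x (Suc i) \<otimes> d (Suc i)) \<otimes> (m (Suc i) \<otimes> mi i)"
proof -
  have inner: "brk v (x (Suc i) \<otimes> d i) (x (Suc i) \<otimes> d (Suc i)) =
      s (- 1) \<otimes> (d i \<otimes> (m (Suc i) \<otimes> x (Suc i)))"
    using I wt v
    by (subst brk_factor[of _ _ "d i \<otimes> x (Suc i)" "x (Suc i)" "d (Suc i)" \<one> _ v])
       (simp_all add: normal_form brk_weight1)
  have outer: "brk (inverse v) (s (- 1) \<otimes> (d i \<otimes> (m (Suc i) \<otimes> x (Suc i)))) (x i \<otimes> d (Suc i)) =
     s (- 1) \<otimes> (d i \<otimes> (x i \<otimes> (m (Suc i) \<otimes> (x (Suc i) \<otimes> d (Suc i))))) \<oplus>
     x i \<otimes> (d i \<otimes> (m (Suc i) \<otimes> (d (Suc i) \<otimes> x (Suc i))))"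
    using I wt v by (simp add: brk_def normal_form)
  show ?thesis unfolding inner outer middle_sum using I wt v by (simp add: normal_form)
qed

end

text \<open>The index shared by the two arguments of the commutator is \<open>i + 1\<close>. For \<open>prev\<close> this is also the node of
  the automorphism, and the generators in question are \<open>B\<^sub>i\<close> and \<open>B\<^bsub>\<rho>(i)\<^esub>\<close>.\<close>

context
  fixes i :: nat
  assumes I: "i \<in> I" "Suc i \<in> I" and wt: "w (Suc i) = v"
begin

lemma T'_B_prev:
  assumes "Suc (Suc i) \<in> I"
  shows "(m (Suc i) \<otimes> x (Suc (Suc i))) \<otimes> d i =
    brk (inverse v) (x (Suc (Suc i)) \<otimes> d (Suc i)) (x (Suc i) \<otimes> d i)"
  using I wt v assms
  by (subst brk_factor[of _ _ "d i" "d (Suc i)" "x (Suc i)" "x (Suc (Suc i))" _ "inverse v"])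
     (simp_all add: normal_form brk_weight1)

lemma T'_B_rho_prev:
  assumes "Suc (Suc i) \<in> I"
  shows "x i \<otimes> (mi (Suc i) \<otimes> d (Suc (Suc i))) =
    brk v (x i \<otimes> d (Suc i)) (x (Suc i) \<otimes> d (Suc (Suc i)))"
  using I wt v assms
  by (subst brk_factor[of _ _ "x i" "d (Suc i)" "x (Suc i)" "d (Suc (Suc i))" _ v])
     (simp_all add: normal_form brk_weight1)

lemma T''_B_prev:
  assumes "Suc (Suc i) \<in> I"
  shows "(s (- 1) \<otimes> (s (inverse v) \<otimes> mi (Suc i) \<otimes> x (Suc (Suc i)))) \<otimes> d i =
    brk (inverse v) (x (Suc i) \<otimes> d i) (x (Suc (Suc i)) \<otimes> d (Suc i))"
  using I wt v assms
  by (subst brk_factor[of _ _ "d i" "x (Suc i)" "d (Suc i)" "x (Suc (Suc i))" _ "inverse v"])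
     (simp_all add: normal_form brk_weight1)

lemma T''_B_rho_prev:
  assumes "Suc (Suc i) \<in> I"
  shows "x i \<otimes> (s (- 1) \<otimes> (s v \<otimes> m (Suc i) \<otimes> d (Suc (Suc i)))) =
    brk v (x (Suc i) \<otimes> d (Suc (Suc i))) (x i \<otimes> d (Suc i))"
  using I wt v assms
  by (subst brk_factor[of _ _ "x i" "x (Suc i)" "d (Suc i)" "d (Suc (Suc i))" _ v])
     (simp_all add: normal_form brk_weight1)

text \<open>The last node \<open>N = r + 1\<close> for \<open>n = 2r + 1\<close>, with \<open>i = r\<close>: the generators \<open>B\<^sub>r\<close>, \<open>B\<^sub>r\<^sub>+\<^sub>2\<close> and \<open>B\<^sub>r\<^sub>+\<^sub>1\<close>
  in this order. The factors \<open>x\<^sub>r\<^sub>+\<^sub>1\<close> of \<open>\<phi>(B\<^sub>r)\<close> and \<open>d\<^sub>r\<^sub>+\<^sub>1\<close> of \<open>\<phi>(B\<^sub>r\<^sub>+\<^sub>2)\<close> are common to both terms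
  of the commutator.\<close>

lemma T'_odd_N:
  "(s (inverse v) \<otimes> m (Suc i) \<otimes> x (Suc i)) \<otimes> d i =
    brk (inverse v) (x (Suc i) \<otimes> d (Suc i)) (x (Suc i) \<otimes> d i)"
  "x i \<otimes> (mi (Suc i) \<otimes> d (Suc i)) =
    brk v (x i \<otimes> d (Suc i)) (x (Suc i) \<otimes> d (Suc i))"
  "(s (inverse v) \<otimes> m (Suc i) \<otimes> x (Suc i)) \<otimes> (mi (Suc i) \<otimes> d (Suc i)) = x (Suc i) \<otimes> d (Suc i)"
  subgoal using I wt v
    by (subst brk_factor[of _ _ "d i \<otimes> x (Suc i)" "d (Suc i)" "x (Suc i)" \<one> _ "inverse v"])
       (simp_all add: normal_form brk_weight1)
  subgoal using I wt v
    by (subst brk_factor[of _ _ "x i" "d (Suc i)" "x (Suc i)" "d (Suc i)" _ v])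
       (simp_all add: normal_form brk_weight1)
  using I wt v by (simp add: normal_form)

lemma T''_odd_N:
  "(s v \<otimes> mi (Suc i) \<otimes> x (Suc i)) \<otimes> d i =
    brk v (x (Suc i) \<otimes> d (Suc i)) (x (Suc i) \<otimes> d i)"
  "x i \<otimes> (m (Suc i) \<otimes> d (Suc i)) =
    brk (inverse v) (x i \<otimes> d (Suc i)) (x (Suc i) \<otimes> d (Suc i))"
  "(s v \<otimes> mi (Suc i) \<otimes> x (Suc i)) \<otimes> (m (Suc i) \<otimes> d (Suc i)) = x (Suc i) \<otimes> d (Suc i)"
  subgoal using I wt v
    by (subst brk_factor[of _ _ "d i \<otimes> x (Suc i)" "d (Suc i)" "x (Suc i)" \<one> _ "v"])
       (simp_all add: normal_form brk_weight1)
  subgoal using I wt v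
    by (subst brk_factor[of _ _ "x i" "d (Suc i)" "x (Suc i)" "d (Suc i)" _ "inverse v"])
       (simp_all add: normal_form brk_weight1)
  using I wt v by (simp add: normal_form)

end

text \<open>The last node \<open>N = r\<close> for \<open>n = 2r\<close>, with \<open>i = r\<close>: the generators \<open>B\<^sub>r\<close> and \<open>B\<^sub>r\<^sub>+\<^sub>1\<close>, first for \<open>\<tau>'\<close> and
  then for \<open>\<tau>''\<close>.\<close>

lemma T_even_N_B:
  assumes "i \<in> I" "Suc i \<in> I" "w i = v" "w (Suc i) = v * v"
  shows
  "(s (inverse v) \<otimes> (m i \<otimes> m i) \<otimes> x (Suc i)) \<otimes> (s (inverse (v * v)) \<otimes> mi i \<otimes> mi (Suc i) \<otimes> d i) =
    (s (inverse v) \<otimes> (m i \<otimes> mi (Suc i))) \<otimes> (x (Suc i) \<otimes> d i)"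
  "(s v \<otimes> m i \<otimes> m (Suc i) \<otimes> x i) \<otimes> (s v \<otimes> (mi i \<otimes> mi i) \<otimes> d (Suc i)) =
    (x i \<otimes> d (Suc i)) \<otimes> (s v \<otimes> (m (Suc i) \<otimes> mi i))"
  "(s v \<otimes> (mi i \<otimes> mi i) \<otimes> x (Suc i)) \<otimes> (s (v * v) \<otimes> m i \<otimes> m (Suc i) \<otimes> d i) =
    (s v \<otimes> (m (Suc i) \<otimes> mi i)) \<otimes> (x (Suc i) \<otimes> d i)"
  "(s (inverse v) \<otimes> mi i \<otimes> mi (Suc i) \<otimes> x i) \<otimes> (s (inverse v) \<otimes> (m i \<otimes> m i) \<otimes> d (Suc i)) =
    (x i \<otimes> d (Suc i)) \<otimes> (s (inverse v) \<otimes> (m i \<otimes> mi (Suc i)))"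
  using assms v by (simp_all add: normal_form mult.assoc v_cancel)

context
  fixes i :: nat
  assumes I: "i \<in> I" "Suc i \<in> I" "Suc (Suc i) \<in> I" and wt: "w (Suc i) = v" "w (Suc (Suc i)) = v * v"
begin

text \<open>The remaining generators at that node, with \<open>i = r - 1\<close>. The inner commutator is of rank one at the
  index \<open>r\<close> and contributes a power of \<open>m\<^sub>r\<close>. Moving this power to the front turns the parameter \<open>v\<close> of
  the outer commutator into \<open>1\<close>, and the outer commutator is then evaluated at the index \<open>r + 1\<close> of
  weight two.\<close>

lemma T'_even_N_prev:
  "(s v \<otimes> m (Suc i) \<otimes> m (Suc (Suc i)) \<otimes> x (Suc i)) \<otimes> d i =
    s (inverse v) \<otimes> brk v (brk v (x (Suc i) \<otimes> d i) (x (Suc (Suc i)) \<otimes> d (Suc i)))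
        (x (Suc i) \<otimes> d (Suc (Suc i)))
    \<oplus> s (- 1) \<otimes> ((s (inverse v) \<otimes> (m (Suc i) \<otimes> mi (Suc (Suc i)))) \<otimes> (x (Suc i) \<otimes> d i))"
proof -
  have inner: "brk v (x (Suc i) \<otimes> d i) (x (Suc (Suc i)) \<otimes> d (Suc i)) =
      s (- v) \<otimes> (d i \<otimes> (m (Suc i) \<otimes> x (Suc (Suc i))))"
    using I wt v
    by (subst brk_factor[of _ _ "d i" "x (Suc i)" "d (Suc i)" "x (Suc (Suc i))" _ v])
       (simp_all add: normal_form mult.assoc v_cancel brk_weight1)
  have outer: "brk v (s (- v) \<otimes> (d i \<otimes> (m (Suc i) \<otimes> x (Suc (Suc i))))) (x (Suc i) \<otimes> d (Suc (Suc i))) =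
      (s (- v) \<otimes> (d i \<otimes> (m (Suc i) \<otimes> x (Suc i)))) \<otimes> (brk 1 (x (Suc (Suc i))) (d (Suc (Suc i))) \<otimes> \<one>)"
    using I wt v by (intro brk_factor) (simp_all add: normal_form mult.assoc v_cancel)
  show ?thesis unfolding inner outer brk_weight2[OF I(3) wt(2)] using I wt v
    by (simp add: normal_form mult.assoc v_cancel r_distr cancel_scaled)
qed

lemma T'_even_N_rho_prev:
  "x i \<otimes> (s (inverse (v * v)) \<otimes> mi (Suc i) \<otimes> mi (Suc (Suc i)) \<otimes> d (Suc i)) =
    s (inverse v) \<otimes> brk v (brk v (x i \<otimes> d (Suc i)) (x (Suc i) \<otimes> d (Suc (Suc i))))
        (x (Suc (Suc i)) \<otimes> d (Suc i))
    \<oplus> s (- 1) \<otimes> ((x i \<otimes> d (Suc i)) \<otimes> (s v \<otimes> (m (Suc (Suc i)) \<otimes> mi (Suc i))))"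
proof -
  have inner: "brk v (x i \<otimes> d (Suc i)) (x (Suc i) \<otimes> d (Suc (Suc i))) =
      x i \<otimes> (mi (Suc i) \<otimes> d (Suc (Suc i)))"
    using I wt v
    by (subst brk_factor[of _ _ "x i" "d (Suc i)" "x (Suc i)" "d (Suc (Suc i))" _ v])
       (simp_all add: normal_form mult.assoc v_cancel brk_weight1)
  have outer: "brk v (x i \<otimes> (mi (Suc i) \<otimes> d (Suc (Suc i)))) (x (Suc (Suc i)) \<otimes> d (Suc i)) =
      (x i \<otimes> (mi (Suc i) \<otimes> d (Suc i))) \<otimes> (brk 1 (d (Suc (Suc i))) (x (Suc (Suc i))) \<otimes> \<one>)"
    using I wt v by (intro brk_factor) (simp_all add: normal_form mult.assoc v_cancel)
  show ?thesis unfolding inner outer brk_weight2[OF I(3) wt(2)] using I wt v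
    by (simp add: normal_form mult.assoc v_cancel r_distr cancel_scaled)
qed

lemma T''_even_N_prev:
  "(s (inverse v) \<otimes> mi (Suc i) \<otimes> mi (Suc (Suc i)) \<otimes> x (Suc i)) \<otimes> d i =
    s (inverse v) \<otimes> brk v (x (Suc i) \<otimes> d (Suc (Suc i)))
       (brk v (x (Suc (Suc i)) \<otimes> d (Suc i)) (x (Suc i) \<otimes> d i))
    \<oplus> s (- 1) \<otimes> ((s v \<otimes> (m (Suc (Suc i)) \<otimes> mi (Suc i))) \<otimes> (x (Suc i) \<otimes> d i))"
proof -
  have inner: "brk v (x (Suc (Suc i)) \<otimes> d (Suc i)) (x (Suc i) \<otimes> d i) =
      d i \<otimes> (mi (Suc i) \<otimes> x (Suc (Suc i)))"
    using I wt v
    by (subst brk_factor[of _ _ "d i" "d (Suc i)" "x (Suc i)" "x (Suc (Suc i))" _ v])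
       (simp_all add: normal_form mult.assoc v_cancel brk_weight1)
  have outer: "brk v (x (Suc i) \<otimes> d (Suc (Suc i))) (d i \<otimes> (mi (Suc i) \<otimes> x (Suc (Suc i)))) =
      (s v \<otimes> (d i \<otimes> (mi (Suc i) \<otimes> x (Suc i)))) \<otimes> (brk 1 (d (Suc (Suc i))) (x (Suc (Suc i))) \<otimes> \<one>)"
    using I wt v by (intro brk_factor) (simp_all add: normal_form mult.assoc v_cancel)
  show ?thesis unfolding inner outer brk_weight2[OF I(3) wt(2)] using I wt v
    by (simp add: normal_form mult.assoc v_cancel r_distr cancel_scaled)
qed

lemma T''_even_N_rho_prev:
  "x i \<otimes> (s (v * v) \<otimes> m (Suc i) \<otimes> m (Suc (Suc i)) \<otimes> d (Suc i)) =
    s (inverse v) \<otimes> brk v (x (Suc (Suc i)) \<otimes> d (Suc i))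
      (brk v (x (Suc i) \<otimes> d (Suc (Suc i))) (x i \<otimes> d (Suc i)))
    \<oplus> s (- 1) \<otimes> ((x i \<otimes> d (Suc i)) \<otimes> (s (inverse v) \<otimes> (m (Suc i) \<otimes> mi (Suc (Suc i)))))"
proof -
  have inner: "brk v (x (Suc i) \<otimes> d (Suc (Suc i))) (x i \<otimes> d (Suc i)) =
      s (- v) \<otimes> (x i \<otimes> (m (Suc i) \<otimes> d (Suc (Suc i))))"
    using I wt v
    by (subst brk_factor[of _ _ "x i" "x (Suc i)" "d (Suc i)" "d (Suc (Suc i))" _ v])
       (simp_all add: normal_form mult.assoc v_cancel brk_weight1)
  have outer: "brk v (x (Suc (Suc i)) \<otimes> d (Suc i)) (s (- v) \<otimes> (x i \<otimes> (m (Suc i) \<otimes> d (Suc (Suc i))))) =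
      (s (- (v * v)) \<otimes> (x i \<otimes> (m (Suc i) \<otimes> d (Suc i)))) \<otimes> (brk 1 (x (Suc (Suc i))) (d (Suc (Suc i))) \<otimes> \<one>)"
    using I wt v by (intro brk_factor) (simp_all add: normal_form mult.assoc v_cancel)
  show ?thesis unfolding inner outer brk_weight2[OF I(3) wt(2)] using I wt v
    by (simp add: normal_form mult.assoc v_cancel r_distr cancel_scaled)
qed

end

end

section \<open>The two presentations\<close>

lemma agens_iff [simp]:
  "Dgen i \<in> agens r \<longleftrightarrow> i \<in> {1..r + 1}" "Xgen i \<in> agens r \<longleftrightarrow> i \<in> {1..r + 1}"
  "Mgen i \<in> agens r \<longleftrightarrow> i \<in> {1..r + 1}" "Minvgen i \<in> agens r \<longleftrightarrow> i \<in> {1..r + 1}"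
  by (auto simp: agens_def)

lemma ugens_iff [simp]:
  "Bgen i \<in> ugens n \<longleftrightarrow> i \<in> {1..n}" "Kgen i \<in> ugens n \<longleftrightarrow> i \<in> Kidx n"
  by (auto simp: ugens_def)

lemma presentation_qweyl: "presentation (qweyl r n)"
proof
  show "snd (qweyl r n) \<subseteq> carrier (free_ring (fst (qweyl r n)))"
    unfolding qweyl_def arels_def fst_conv snd_conv by (intro Un_least UN_least) auto
qed

lemma presentation_iqg: "presentation (iqg r n)"
proof
  let ?C = "carrier (free_ring (ugens n))"
  have B: "\<B> i \<in> ?C" if "i \<in> {1..n}" for i
    using that by simp
  have K: "\<K> i \<in> ?C" "\<K> (rho n i) \<in> ?C" if "i \<in> Kidx n" for i
    using that by (auto simp: Kidx_def rho_def)
  have Kidx: "i \<in> Kidx n" if "i \<in> {1..n}" "cdot i (rho n i) \<le> 0" for i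
    using that by (auto simp: Kidx_def cdot_def)
  have "\<K> i * \<K> (rho n i) - 1 \<in> ?C" if "i \<in> Kidx n" for i
    using K[OF that] by simp
  moreover have "\<K> i * \<K> j - \<K> j * \<K> i \<in> ?C" if "i \<in> Kidx n" "j \<in> Kidx n" for i j
    using K(1)[OF that(1)] K(1)[OF that(2)] by simp
  moreover have "\<K> i * \<B> j - scal c * (\<B> j * \<K> i) \<in> ?C" if "i \<in> Kidx n" "j \<in> {1..n}" for i j c
    using K(1)[OF that(1)] B[OF that(2)] by simp
  moreover have "\<B> j * \<B> i - \<B> i * \<B> j
      - (if rho n i = j then scal c * (\<K> i - \<K> (rho n i)) else 0) \<in> ?C"
    if "i \<in> {1..n}" "j \<in> {1..n}" "cdot i j = 0" for i j c
    using B[OF that(1)] B[OF that(2)] Kidx[OF that(1)] K[of i] that(3) by auto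
  moreover have "\<B> i ^ 2 * \<B> j - scal c * (\<B> i * \<B> j * \<B> i) + \<B> j * \<B> i ^ 2
        - ((if i = rho n i then \<B> j else 0)
           - (if j = rho n i then scal c * (\<B> i * (scal a * \<K> i + scal b * \<K> (rho n i))) else 0)) \<in> ?C"
    if "i \<in> {1..n}" "j \<in> {1..n}" "cdot i j = - 1" for i j c a b
    using B[OF that(1)] B[OF that(2)] Kidx[OF that(1)] K[of i] that(3) by auto
  ultimately show "snd (iqg r n) \<subseteq> carrier (free_ring (fst (iqg r n)))"
    unfolding iqg_def urels_def fst_conv snd_conv by blast
qed

text \<open>The case \<open>e = 1\<close> of the locale; the case \<open>e = -1\<close> follows from it by inversion.\<close>

lemma qweyl_ring_qweyl:
  "qweyl_ring (palg (qweyl r n)) (\<lambda>c. cls (qweyl r n) (scal c)) (\<lambda>i. cls (qweyl r n) (\<dd> i))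
     (\<lambda>i. cls (qweyl r n) (\<xx> i)) (\<lambda>i. cls (qweyl r n) (\<mm> i)) (\<lambda>i. cls (qweyl r n) (\<mm>inv i))
     {1..r + 1} (\<lambda>i. qq powi cwt r n i) qq"
proof -
  interpret presentation "qweyl r n" by (rule presentation_qweyl)
  let ?I = "{1..r + 1}"
  have [simp]: "fst (qweyl r n) = agens r" by (simp add: qweyl_def)
  have rel: "cls (qweyl r n) p = cls (qweyl r n) p'"
    if "p - p' \<in> arels r n" "p \<in> carrier F" "p' \<in> carrier F" for p p'
    using cls_eqI[of p p'] that by (simp add: qweyl_def)
  have neg: "s (- 1) \<otimes>\<^bsub>A\<^esub> (s c \<otimes>\<^bsub>A\<^esub> u) = s (- c) \<otimes>\<^bsub>A\<^esub> u" if "u \<in> carrier A" for c u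
    using that s_simps(2)[of "- 1" c] by (simp add: A.m_assoc)
  show ?thesis
  proof
    fix i j assume i: "i \<in> ?I"
    have "\<mm> i * \<mm>inv i - 1 \<in> arels r n" "\<mm>inv i * \<mm> i - 1 \<in> arels r n"
      using i unfolding arels_def by blast+
    from this[THEN rel] i show "cls (qweyl r n) (\<mm> i) \<otimes>\<^bsub>A\<^esub> cls (qweyl r n) (\<mm>inv i) = \<one>\<^bsub>A\<^esub>"
      "cls (qweyl r n) (\<mm>inv i) \<otimes>\<^bsub>A\<^esub> cls (qweyl r n) (\<mm> i) = \<one>\<^bsub>A\<^esub>" by simp_all
    have "\<dd> i * \<mm> i - qs (cwt r n i) * (\<mm> i * \<dd> i) \<in> arels r n"
      "\<xx> i * \<mm> i - qs (- cwt r n i) * (\<mm> i * \<xx> i) \<in> arels r n"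
      using i unfolding arels_def by blast+
    from this[THEN rel] i show
      "cls (qweyl r n) (\<dd> i) \<otimes>\<^bsub>A\<^esub> cls (qweyl r n) (\<mm> i) =
        s (qq powi cwt r n i) \<otimes>\<^bsub>A\<^esub> (cls (qweyl r n) (\<mm> i) \<otimes>\<^bsub>A\<^esub> cls (qweyl r n) (\<dd> i))"
      "cls (qweyl r n) (\<xx> i) \<otimes>\<^bsub>A\<^esub> cls (qweyl r n) (\<mm> i) =
        s (inverse (qq powi cwt r n i)) \<otimes>\<^bsub>A\<^esub> (cls (qweyl r n) (\<mm> i) \<otimes>\<^bsub>A\<^esub> cls (qweyl r n) (\<xx> i))"
      by (simp_all add: power_int_minus)
    have "\<dd> i * \<xx> i - scal (inverse (qq - inverse qq)) *
           (qs (cwt r n i) * \<mm> i - qs (- cwt r n i) * \<mm>inv i) \<in> arels r n"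
      "\<xx> i * \<dd> i - scal (inverse (qq - inverse qq)) * (\<mm> i - \<mm>inv i) \<in> arels r n"
      using i unfolding arels_def by blast+
    from this[THEN rel] i show
      "cls (qweyl r n) (\<dd> i) \<otimes>\<^bsub>A\<^esub> cls (qweyl r n) (\<xx> i) =
        s (inverse (qq - inverse qq)) \<otimes>\<^bsub>A\<^esub>
         (s (qq powi cwt r n i) \<otimes>\<^bsub>A\<^esub> cls (qweyl r n) (\<mm> i) \<oplus>\<^bsub>A\<^esub>
          s (- inverse (qq powi cwt r n i)) \<otimes>\<^bsub>A\<^esub> cls (qweyl r n) (\<mm>inv i))"
      "cls (qweyl r n) (\<xx> i) \<otimes>\<^bsub>A\<^esub> cls (qweyl r n) (\<dd> i) =
        s (inverse (qq - inverse qq)) \<otimes>\<^bsub>A\<^esub>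
         (cls (qweyl r n) (\<mm> i) \<oplus>\<^bsub>A\<^esub> s (- 1) \<otimes>\<^bsub>A\<^esub> cls (qweyl r n) (\<mm>inv i))"
      by (simp_all add: power_int_minus neg)
    assume j: "j \<in> ?I"
    have "\<mm> i * \<mm> j - \<mm> j * \<mm> i \<in> arels r n" "\<dd> i * \<dd> j - \<dd> j * \<dd> i \<in> arels r n"
      "\<xx> i * \<xx> j - \<xx> j * \<xx> i \<in> arels r n"
      using i j unfolding arels_def by blast+
    from this[THEN rel] i j show
      "cls (qweyl r n) (\<mm> i) \<otimes>\<^bsub>A\<^esub> cls (qweyl r n) (\<mm> j) = cls (qweyl r n) (\<mm> j) \<otimes>\<^bsub>A\<^esub> cls (qweyl r n) (\<mm> i)"
      "cls (qweyl r n) (\<dd> i) \<otimes>\<^bsub>A\<^esub> cls (qweyl r n) (\<dd> j) = cls (qweyl r n) (\<dd> j) \<otimes>\<^bsub>A\<^esub> cls (qweyl r n) (\<dd> i)"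
      "cls (qweyl r n) (\<xx> i) \<otimes>\<^bsub>A\<^esub> cls (qweyl r n) (\<xx> j) = cls (qweyl r n) (\<xx> j) \<otimes>\<^bsub>A\<^esub> cls (qweyl r n) (\<xx> i)"
      by simp_all
    assume ij: "i \<noteq> j"
    have "\<dd> i * \<mm> j - \<mm> j * \<dd> i \<in> arels r n" "\<xx> i * \<mm> j - \<mm> j * \<xx> i \<in> arels r n"
      "\<dd> i * \<xx> j - \<xx> j * \<dd> i \<in> arels r n"
      using i j ij unfolding arels_def by blast+
    from this[THEN rel] i j show
      "cls (qweyl r n) (\<dd> i) \<otimes>\<^bsub>A\<^esub> cls (qweyl r n) (\<mm> j) = cls (qweyl r n) (\<mm> j) \<otimes>\<^bsub>A\<^esub> cls (qweyl r n) (\<dd> i)"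
      "cls (qweyl r n) (\<xx> i) \<otimes>\<^bsub>A\<^esub> cls (qweyl r n) (\<mm> j) = cls (qweyl r n) (\<mm> j) \<otimes>\<^bsub>A\<^esub> cls (qweyl r n) (\<xx> i)"
      "cls (qweyl r n) (\<dd> i) \<otimes>\<^bsub>A\<^esub> cls (qweyl r n) (\<xx> j) = cls (qweyl r n) (\<xx> j) \<otimes>\<^bsub>A\<^esub> cls (qweyl r n) (\<dd> i)"
      by simp_all
  qed (simp_all add: s_simps(1-3) qq_nonzero qq_square, rule s_central)
qed

section \<open>The homomorphism on generators\<close>

locale phi_setting =
  fixes r n :: nat and e :: int and \<phi> :: "ugen freealg set \<Rightarrow> agen freealg set"
  assumes r: "r \<ge> 1" and n: "n = 2 * r \<or> n = 2 * r + 1" and e: "e \<in> {1, - 1}"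
    and phi: "is_phi r n \<phi>"
begin

abbreviation "U \<equiv> iqg r n"
abbreviation "W \<equiv> qweyl r n"
abbreviation "v \<equiv> qq powi e"
abbreviation "d i \<equiv> cls W (\<dd> i)"
abbreviation "x i \<equiv> cls W (\<xx> i)"
abbreviation "m i \<equiv> cls W (Mpow i e)"
abbreviation "mi i \<equiv> cls W (Mpow i (- e))"

sublocale U: presentation U by (rule presentation_iqg)
sublocale W: presentation W by (rule presentation_qweyl)
sublocale phi: presented_hom U W \<phi>
  using phi by unfold_locales (simp add: is_phi_def)

lemma generator_sets [simp]: "fst U = ugens n" "fst W = agens r"
  by (simp_all add: iqg_def qweyl_def)

text \<open>Two instances of the relations: with \<open>q\<close> itself, for the values on the \<open>K\<^sub>j\<close>, which do not depend on
  \<open>e\<close>, and with \<open>v = q\<^sup>e\<close>, for the values on the \<open>B\<^sub>j\<close>.\<close>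

sublocale pos: qweyl_ring "palg W" W.s d x "\<lambda>i. cls W (\<mm> i)" "\<lambda>i. cls W (\<mm>inv i)" "{1..r + 1}"
    "\<lambda>i. qq powi cwt r n i" qq
  by (rule qweyl_ring_qweyl)

sublocale qweyl_ring "palg W" W.s d x m mi "{1..r + 1}" "\<lambda>i. v powi cwt r n i" v
  using e pos.qweyl_ring_inverse pos.qweyl_ring_axioms
  by (auto simp: Mpow_def power_int_inverse power_int_minus)

lemma Kidx_iff: "j \<in> Kidx n \<longleftrightarrow> j \<in> {1..r} \<or> j \<in> rho n ` {1..r}"
proof
  assume j: "j \<in> Kidx n"
  have "j \<in> {1..r} \<or> rho n j \<in> {1..r} \<and> j = rho n (rho n j)"
    using n j by (auto simp: Kidx_def rho_def)
  then show "j \<in> {1..r} \<or> j \<in> rho n ` {1..r}" by blast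
next
  assume "j \<in> {1..r} \<or> j \<in> rho n ` {1..r}"
  then show "j \<in> Kidx n" using n by (auto simp: Kidx_def rho_def)
qed

lemma B_index_cases:
  assumes "j \<in> {1..n}"
  obtains "j \<in> {1..r}" | k where "k \<in> {1..r}" "j = rho n k" | "n = 2 * r + 1" "j = r + 1"
proof -
  have "j \<in> {1..r} \<or> rho n j \<in> {1..r} \<and> j = rho n (rho n j) \<or> n = 2 * r + 1 \<and> j = r + 1"
    using n assms by (auto simp: rho_def)
  then show thesis using that by blast
qed

lemma rho_range [simp]: "j \<in> {1..r} \<Longrightarrow> rho n j \<in> {1..n}" "j \<in> {1..r} \<Longrightarrow> rho n (rho n j) = j"
  using n by (auto simp: rho_def)

lemma rho_bounds [simp]: "1 \<le> j \<Longrightarrow> j \<le> r \<Longrightarrow> Suc 0 \<le> rho n j" "1 \<le> j \<Longrightarrow> j \<le> r \<Longrightarrow> rho n j \<le> n"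
  "j \<le> r \<Longrightarrow> j \<le> n"
  using n by (auto simp: rho_def)

lemma K_inverse:
  assumes "j \<in> {1..r}"
  shows "cls U (\<K> j) \<otimes>\<^bsub>palg U\<^esub> cls U (\<K> (rho n j)) = \<one>\<^bsub>palg U\<^esub>"
    "cls U (\<K> (rho n j)) \<otimes>\<^bsub>palg U\<^esub> cls U (\<K> j) = \<one>\<^bsub>palg U\<^esub>"
proof -
  have *: "cls U (\<K> k) \<otimes>\<^bsub>palg U\<^esub> cls U (\<K> (rho n k)) = \<one>\<^bsub>palg U\<^esub>" if "k \<in> Kidx n" "rho n k \<in> Kidx n" for k
  proof -
    have "\<K> k * \<K> (rho n k) - 1 \<in> snd U"
      using that unfolding iqg_def urels_def snd_conv by blast
    then show ?thesis using U.cls_eqI[of "\<K> k * \<K> (rho n k)" 1] that by simp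
  qed
  show "cls U (\<K> j) \<otimes>\<^bsub>palg U\<^esub> cls U (\<K> (rho n j)) = \<one>\<^bsub>palg U\<^esub>"
    "cls U (\<K> (rho n j)) \<otimes>\<^bsub>palg U\<^esub> cls U (\<K> j) = \<one>\<^bsub>palg U\<^esub>"
    using *[of j] *[of "rho n j"] assms by (auto simp: Kidx_iff)
qed

lemma phi_B:
  "j \<in> {1..r} \<Longrightarrow> \<phi> (cls U (\<B> j)) = x (Suc j) \<otimes>\<^bsub>palg W\<^esub> d j"
  "j \<in> {1..r} \<Longrightarrow> \<phi> (cls U (\<B> (rho n j))) = x j \<otimes>\<^bsub>palg W\<^esub> d (Suc j)"
  "n = 2 * r + 1 \<Longrightarrow> \<phi> (cls U (\<B> (Suc r))) = x (Suc r) \<otimes>\<^bsub>palg W\<^esub> d (Suc r)"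
proof -
  assume j: "j \<in> {1..r}"
  have "\<phi> (cls U (\<B> j)) = cls W (\<xx> (j + 1) * \<dd> j)" "\<phi> (cls U (\<B> (rho n j))) = cls W (\<xx> j * \<dd> (j + 1))"
    using phi j unfolding is_phi_def by blast+
  then show "\<phi> (cls U (\<B> j)) = x (Suc j) \<otimes>\<^bsub>palg W\<^esub> d j"
    "\<phi> (cls U (\<B> (rho n j))) = x j \<otimes>\<^bsub>palg W\<^esub> d (Suc j)"
    using j by simp_all
next
  assume "n = 2 * r + 1"
  then have "\<phi> (cls U (\<B> (r + 1))) = cls W (\<xx> (r + 1) * \<dd> (r + 1))"
    using phi unfolding is_phi_def by blast
  then show "\<phi> (cls U (\<B> (Suc r))) = x (Suc r) \<otimes>\<^bsub>palg W\<^esub> d (Suc r)" by simp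
qed

text \<open>The exponent of \<open>q\<^sup>-\<^sup>1\<close> in \<open>\<phi>(K\<^sub>j)\<close>.\<close>

definition kappa :: "nat \<Rightarrow> int" where "kappa j = (if n = 2 * r \<and> j = r then 1 else 0)"

lemma phi_K:
  assumes "j \<in> {1..r}"
  shows "\<phi> (cls U (\<K> j)) =
      W.s (qq powi (- kappa j)) \<otimes>\<^bsub>palg W\<^esub> (cls W (\<mm> j) \<otimes>\<^bsub>palg W\<^esub> cls W (\<mm>inv (Suc j)))"
    "\<phi> (cls U (\<K> (rho n j))) =
      W.s (qq powi kappa j) \<otimes>\<^bsub>palg W\<^esub> (cls W (\<mm> (Suc j)) \<otimes>\<^bsub>palg W\<^esub> cls W (\<mm>inv j))"
proof -
  have "\<phi> (cls U (\<K> j)) = cls W (qs (- kappa j) * \<mm> j * \<mm>inv (j + 1)) \<and>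
      \<phi> (cls U (\<K> (rho n j))) = cls W (qs (kappa j) * \<mm> (j + 1) * \<mm>inv j)"
    using phi assms unfolding is_phi_def Let_def kappa_def by blast
  then show "\<phi> (cls U (\<K> j)) =
      W.s (qq powi (- kappa j)) \<otimes>\<^bsub>palg W\<^esub> (cls W (\<mm> j) \<otimes>\<^bsub>palg W\<^esub> cls W (\<mm>inv (Suc j)))"
    "\<phi> (cls U (\<K> (rho n j))) =
      W.s (qq powi kappa j) \<otimes>\<^bsub>palg W\<^esub> (cls W (\<mm> (Suc j)) \<otimes>\<^bsub>palg W\<^esub> cls W (\<mm>inv j))"
    using assms by (simp_all add: W.A.m_assoc)
qed

text \<open>For \<open>e = -1\<close> the representative of \<open>K\<^sub>j\<^sup>e\<close> is the generator \<open>K\<^bsub>\<rho>(j)\<^esub>\<close>, so both signs lead to the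
  same formula in \<open>v\<close> and \<open>m\<close>.\<close>

lemma phi_Kpow:
  assumes "j \<in> {1..r}"
  shows "\<phi> (cls U (Kpow n j e)) = W.s (v powi (- kappa j)) \<otimes>\<^bsub>palg W\<^esub> (m j \<otimes>\<^bsub>palg W\<^esub> mi (Suc j))"
    "\<phi> (cls U (Kpow n (rho n j) e)) = W.s (v powi kappa j) \<otimes>\<^bsub>palg W\<^esub> (m (Suc j) \<otimes>\<^bsub>palg W\<^esub> mi j)"
proof -
  have swap: "cls W (\<mm> (Suc j)) \<otimes>\<^bsub>palg W\<^esub> cls W (\<mm>inv j) = cls W (\<mm>inv j) \<otimes>\<^bsub>palg W\<^esub> cls W (\<mm> (Suc j))"
    "cls W (\<mm> j) \<otimes>\<^bsub>palg W\<^esub> cls W (\<mm>inv (Suc j)) = cls W (\<mm>inv (Suc j)) \<otimes>\<^bsub>palg W\<^esub> cls W (\<mm> j)"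
    using assms pos.commute_ne[of "Suc j" j "cls W (\<mm> (Suc j))" "cls W (\<mm>inv j)"]
      pos.commute_ne[of j "Suc j" "cls W (\<mm> j)" "cls W (\<mm>inv (Suc j))"] by simp_all
  have "e = 1 \<or> e = - 1" using e by blast
  then show "\<phi> (cls U (Kpow n j e)) = W.s (v powi (- kappa j)) \<otimes>\<^bsub>palg W\<^esub> (m j \<otimes>\<^bsub>palg W\<^esub> mi (Suc j))"
    using assms phi_K[OF assms] swap
    by (elim disjE) (simp_all add: Kpow_def Mpow_def power_int_minus power_int_inverse)
  from \<open>e = 1 \<or> e = - 1\<close>
  show "\<phi> (cls U (Kpow n (rho n j) e)) = W.s (v powi kappa j) \<otimes>\<^bsub>palg W\<^esub> (m (Suc j) \<otimes>\<^bsub>palg W\<^esub> mi j)"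
    using assms phi_K[OF assms] swap
    by (elim disjE) (simp_all add: Kpow_def Mpow_def power_int_minus power_int_inverse)
qed

section \<open>Comparing homomorphisms on generators\<close>

text \<open>Agreement at \<open>K\<^bsub>\<rho>(j)\<^esub>\<close> follows from agreement at \<open>K\<^sub>j\<close>, since both maps send \<open>K\<^bsub>\<rho>(j)\<^esub>\<close> to an inverse of
  the common image of \<open>K\<^sub>j\<close>.\<close>

lemma intertwine:
  assumes \<tau>: "alg_aut U \<tau>" and T: "alg_aut W T"
    and K: "\<And>j. j \<in> {1..r} \<Longrightarrow> T (\<phi> (cls U (\<K> j))) = \<phi> (\<tau> (cls U (\<K> j)))"
    and B: "\<And>j. j \<in> {1..r} \<Longrightarrow> T (\<phi> (cls U (\<B> j))) = \<phi> (\<tau> (cls U (\<B> j)))"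
    and B_rho: "\<And>j. j \<in> {1..r} \<Longrightarrow> T (\<phi> (cls U (\<B> (rho n j)))) = \<phi> (\<tau> (cls U (\<B> (rho n j))))"
    and B_mid: "n = 2 * r + 1 \<Longrightarrow> T (\<phi> (cls U (\<B> (Suc r)))) = \<phi> (\<tau> (cls U (\<B> (Suc r))))"
    and u: "u \<in> carrier (palg U)"
  shows "T (\<phi> u) = \<phi> (\<tau> u)"
proof -
  interpret \<tau>: presented_hom U U \<tau>
    using \<tau> by unfold_locales (simp add: alg_aut_def)
  interpret T: presented_hom W W T
    using T by unfold_locales (simp add: alg_aut_def)
  have K_rho: "T (\<phi> (cls U (\<K> (rho n j)))) = \<phi> (\<tau> (cls U (\<K> (rho n j))))" if j: "j \<in> {1..r}" for j
  proof -
    let ?k = "cls U (\<K> j)" and ?k' = "cls U (\<K> (rho n j))"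
    have [simp]: "?k \<in> carrier (palg U)" "?k' \<in> carrier (palg U)"
      using j by (auto simp: Kidx_iff)
    have "T (\<phi> ?k') \<otimes>\<^bsub>palg W\<^esub> T (\<phi> ?k) = \<one>\<^bsub>palg W\<^esub>"
      using K_inverse(2)[OF j] by (simp flip: phi.hom_simps(3) T.hom_simps(3))
    moreover have "T (\<phi> ?k) \<otimes>\<^bsub>palg W\<^esub> \<phi> (\<tau> ?k') = \<one>\<^bsub>palg W\<^esub>"
      using K_inverse(1)[OF j] by (simp add: K[OF j] flip: phi.hom_simps(3) \<tau>.hom_simps(3))
    ultimately show ?thesis by (rule W.A.inv_unique) simp_all
  qed
  show ?thesis using u
  proof (induction rule: U.palg_induct)
    case (gen g)
    show ?case
    proof (cases g)
      case (Bgen j)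
      then have "j \<in> {1..n}" using gen by simp
      then show ?thesis unfolding Bgen using B B_rho B_mid by (cases rule: B_index_cases) auto
    next
      case (Kgen j)
      then show ?thesis using gen K K_rho by (auto simp: Kidx_iff)
    qed
  qed simp_all
qed

text \<open>The value at \<open>\<mm>\<^sub>j\<^sup>-\<^sup>1\<close> inverts the value at \<open>\<mm>\<^sub>j\<close>.\<close>

lemma T_minv:
  assumes T: "alg_aut W T" and Tm: "\<And>j. j \<in> {1..r + 1} \<Longrightarrow> T (cls W (\<mm> j)) = cls W (T_M n i j)"
    and i: "i \<in> {1..NN n}"
  shows "j \<in> {1..r + 1} \<Longrightarrow> T (cls W (\<mm>inv j)) =
    cls W (if i < NN n \<and> j = i then \<mm>inv (Suc i) else if i < NN n \<and> j = Suc i then \<mm>inv i else \<mm>inv j)"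
  (is "_ \<Longrightarrow> _ = cls W ?y")
proof -
  assume j: "j \<in> {1..r + 1}"
  interpret T: presented_hom W W T
    using T by unfold_locales (simp add: alg_aut_def)
  have range: "Suc i \<in> {1..r + 1}" "i \<in> {1..r + 1}" if "i < NN n" using i n that by (auto simp: NN_def)
  have "T (cls W (\<mm>inv j)) \<otimes>\<^bsub>palg W\<^esub> T (cls W (\<mm> j)) = \<one>\<^bsub>palg W\<^esub>"
    using j by (simp add: pos.mi_m flip: T.hom_simps(3))
  moreover have "T (cls W (\<mm> j)) \<otimes>\<^bsub>palg W\<^esub> cls W ?y = \<one>\<^bsub>palg W\<^esub>"
    using j range by (auto simp: Tm T_M_def pos.m_mi)
  moreover have "cls W ?y \<in> carrier (palg W)"
    using j range by auto
  ultimately show ?thesis using j by (intro W.A.inv_unique[of "T (cls W (\<mm>inv j))" "T (cls W (\<mm> j))"]) simp_all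
qed

text \<open>On the torus part, \<open>T\<^sub>i\<close> exchanges \<open>\<mm>\<^sub>i\<close> and \<open>\<mm>\<^sub>i\<^sub>+\<^sub>1\<close>, which inverts \<open>\<mm>\<^sub>i \<mm>\<^sub>i\<^sub>+\<^sub>1\<^sup>-\<^sup>1\<close> and multiplies the images of
  the neighbouring \<open>K\<^sub>j\<close> by it. The scalars agree because \<open>\<phi>(K\<^sub>i)\<close> carries no power of \<open>q\<close> when \<open>i < N\<close>.\<close>

lemma intertwine_K:
  assumes T: "alg_aut W T" and Tm: "\<And>j. j \<in> {1..r + 1} \<Longrightarrow> T (cls W (\<mm> j)) = cls W (T_M n i j)"
    and i: "i \<in> {1..NN n}" and \<tau>: "\<tau> (cls U (\<K> j)) = cls U (tau_K n i j)" and j: "j \<in> {1..r}"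
  shows "T (\<phi> (cls U (\<K> j))) = \<phi> (\<tau> (cls U (\<K> j)))"
proof -
  interpret T: presented_hom W W T
    using T by unfold_locales (simp add: alg_aut_def)
  have minv: "T (cls W (\<mm>inv (Suc j))) = cls W (if i < NN n \<and> Suc j = i then \<mm>inv (Suc i)
      else if i < NN n \<and> Suc j = Suc i then \<mm>inv i else \<mm>inv (Suc j))"
    using j by (intro T_minv[OF T Tm i]) simp_all
  have lhs: "T (\<phi> (cls U (\<K> j))) = W.s (qq powi (- kappa j)) \<otimes>\<^bsub>palg W\<^esub>
      (cls W (T_M n i j) \<otimes>\<^bsub>palg W\<^esub> T (cls W (\<mm>inv (Suc j))))"
    using j by (simp add: phi_K Tm)
  have Kcl [simp]: "k \<in> Kidx n" "rho n k \<in> Kidx n" if "k \<in> {1..r}" for k using that by (auto simp: Kidx_iff)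
  show ?thesis
  proof (cases "i < NN n")
    case False
    then show ?thesis using j minv unfolding lhs \<tau> by (simp add: phi_K T_M_def tau_K_def)
  next
    case True
    then have ir: "i \<in> {1..r}" "n = 2 * r \<Longrightarrow> i < r" using i n by (auto simp: NN_def)
    have kappa_i: "kappa i = 0" using ir n by (auto simp: kappa_def)
    consider "j = i" | "j = Suc i" | "i = Suc j" | "j \<noteq> i" "j \<noteq> Suc i" "i \<noteq> Suc j" by blast
    then show ?thesis
    proof cases
      case 1
      then show ?thesis using j True ir kappa_i minv unfolding lhs \<tau>
        by (simp add: phi_K T_M_def tau_K_def)
    next
      case 2
      then have "\<phi> (cls U (tau_K n i j)) = \<phi> (cls U (\<K> i)) \<otimes>\<^bsub>palg W\<^esub> \<phi> (cls U (\<K> j))"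
        using True j ir by (simp add: tau_K_def)
      then show ?thesis using 2 j True ir kappa_i minv unfolding lhs \<tau>
        by (simp add: phi_K kappa_i T_M_def pos.normal_form)
    next
      case 3
      then have "\<phi> (cls U (tau_K n i j)) = \<phi> (cls U (\<K> i)) \<otimes>\<^bsub>palg W\<^esub> \<phi> (cls U (\<K> j))"
        using True j ir by (simp add: tau_K_def)
      then show ?thesis using 3 j True ir kappa_i minv unfolding lhs \<tau>
        by (simp add: phi_K kappa_i T_M_def pos.normal_form)
    next
      case 4
      then show ?thesis using j True minv unfolding lhs \<tau>
        by (simp add: phi_K T_M_def tau_K_def)
    qed
  qed
qed

lemma Mpow_two:
  "cls W (Mpow j (2 * e)) = m j \<otimes>\<^bsub>palg W\<^esub> m j" "cls W (Mpow j (- (2 * e))) = mi j \<otimes>\<^bsub>palg W\<^esub> mi j"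
  if "j \<in> {1..r + 1}" for j
  using e that by (auto simp: Mpow_def power2_eq_square eval_nat_numeral)

lemma Mpow_closed [simp]: "j \<in> {1..r + 1} \<Longrightarrow> Mpow j k \<in> carrier (free_ring (agens r))"
  by (simp add: Mpow_def)

lemma Kpow_closed [simp]:
  "j \<in> {1..r} \<Longrightarrow> Kpow n j k \<in> carrier (free_ring (ugens n))"
  "j \<in> {1..r} \<Longrightarrow> Kpow n (rho n j) k \<in> carrier (free_ring (ugens n))"
  by (auto simp: Kpow_def Kidx_iff)

lemma q_powers: "qq powi (- e) = inverse v" "qq powi (2 * e) = v * v" "qq powi (- (2 * e)) = inverse (v * v)"
  using e by (auto simp: power_int_minus power2_eq_square)

lemma powi_weight:
  "n = 2 * r + 1 \<or> j \<noteq> Suc r \<Longrightarrow> v powi cwt r n j = v"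
  "n = 2 * r \<Longrightarrow> v powi cwt r n (Suc r) = v * v"
  by (auto simp: cwt_def power2_eq_square)

text \<open>The reduction of \<open>T\<^sub>i \<circ> \<phi> = \<phi> \<circ> \<tau>\<^sub>i\<close> to one identity for each \<open>B\<^sub>j\<close>. It is stated for arbitrary values
  \<open>tB\<close>, \<open>TX\<close>, \<open>TD\<close> on the generators, so that it covers both families of automorphisms and all nodes.\<close>

lemma intertwine_images:
  assumes \<tau>: "alg_aut U \<tau>" "\<forall>j\<in>{1..r}. \<tau> (cls U (\<K> j)) = cls U (tau_K n i j)"
      "\<forall>j\<in>{1..n}. \<tau> (cls U (\<B> j)) = cls U (tB j)"
    and T: "alg_aut W T" "\<forall>j\<in>{1..r + 1}. T (cls W (\<mm> j)) = cls W (T_M n i j) \<and>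
      T (cls W (\<dd> j)) = cls W (TD j) \<and> T (cls W (\<xx> j)) = cls W (TX j)"
    and i: "i \<in> {1..NN n}"
    and B: "\<And>j. j \<in> {1..r} \<Longrightarrow> cls W (TX (Suc j)) \<otimes>\<^bsub>palg W\<^esub> cls W (TD j) = \<phi> (cls U (tB j))"
    and B_rho: "\<And>j. j \<in> {1..r} \<Longrightarrow> cls W (TX j) \<otimes>\<^bsub>palg W\<^esub> cls W (TD (Suc j)) = \<phi> (cls U (tB (rho n j)))"
    and B_mid: "n = 2 * r + 1 \<Longrightarrow> cls W (TX (Suc r)) \<otimes>\<^bsub>palg W\<^esub> cls W (TD (Suc r)) = \<phi> (cls U (tB (Suc r)))"
    and u: "u \<in> carrier (palg U)"
  shows "T (\<phi> u) = \<phi> (\<tau> u)"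
proof -
  interpret T: presented_hom W W T
    using T by unfold_locales (simp add: alg_aut_def)
  have Tv: "T (x j) = cls W (TX j)" "T (d j) = cls W (TD j)" "T (cls W (\<mm> j)) = cls W (T_M n i j)"
    if "j \<in> {1..r + 1}" for j
    using T(2) that by blast+
  have \<tau>B: "\<tau> (cls U (\<B> j)) = cls U (tB j)" if "j \<in> {1..n}" for j
    using \<tau>(3) that by blast
  show ?thesis
  proof (rule intertwine[OF \<tau>(1) T(1) _ _ _ _ u])
    fix j assume j: "j \<in> {1..r}"
    show "T (\<phi> (cls U (\<K> j))) = \<phi> (\<tau> (cls U (\<K> j)))"
      using \<tau>(2) j by (intro intertwine_K[OF T(1) Tv(3) i]) auto
    show "T (\<phi> (cls U (\<B> j))) = \<phi> (\<tau> (cls U (\<B> j)))"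
      using j B[OF j] by (simp add: phi_B Tv \<tau>B)
    show "T (\<phi> (cls U (\<B> (rho n j)))) = \<phi> (\<tau> (cls U (\<B> (rho n j))))"
      using j B_rho[OF j] by (simp add: phi_B Tv \<tau>B)
  next
    assume odd: "n = 2 * r + 1"
    then have "Suc r \<in> {1..n}" by simp
    from \<tau>B[OF this] show "T (\<phi> (cls U (\<B> (Suc r)))) = \<phi> (\<tau> (cls U (\<B> (Suc r))))"
      using B_mid[OF odd] phi_B(3)[OF odd] by (simp add: Tv)
  qed
qed

section \<open>The nodes \<open>i < N\<close>\<close>

text \<open>For \<open>i < N\<close> and \<open>j \<le> r\<close> one has \<open>i + j < n\<close>. So \<open>i\<close> is neither equal nor adjacent to \<open>\<rho>(j)\<close>, nor is \<open>j\<close> to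
  \<open>\<rho>(i)\<close>, and the cases in the definition of \<open>\<tau>'\<^sub>i\<close> exclude each other at \<open>B\<^sub>j\<close> and \<open>B\<^bsub>\<rho>(j)\<^esub>\<close>. The middle index
  \<open>r + 1\<close> of \<open>n = 2r + 1\<close> is adjacent to both \<open>r\<close> and \<open>\<rho>(r)\<close>; this is the special case \<open>i = r\<close>.\<close>

lemma tau'_B_lt:
  assumes "i \<in> {1..r}" "i < NN n" "j \<in> {1..r}"
  shows "tau'_B r n e i i = - (\<B> (rho n i) * Kpow n (rho n i) e)"
    "tau'_B r n e i (rho n i) = - (Kpow n i e * \<B> i)"
    "j = Suc i \<or> i = Suc j \<Longrightarrow> tau'_B r n e i j = qbr (- e) (\<B> i) (\<B> j)"
    "j = Suc i \<or> i = Suc j \<Longrightarrow> tau'_B r n e i (rho n j) = qbr e (\<B> (rho n j)) (\<B> (rho n i))"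
    "j \<noteq> i \<Longrightarrow> j \<noteq> Suc i \<Longrightarrow> i \<noteq> Suc j \<Longrightarrow> tau'_B r n e i j = \<B> j"
    "j \<noteq> i \<Longrightarrow> j \<noteq> Suc i \<Longrightarrow> i \<noteq> Suc j \<Longrightarrow> tau'_B r n e i (rho n j) = \<B> (rho n j)"
    "n = 2 * r + 1 \<Longrightarrow> i \<noteq> r \<Longrightarrow> tau'_B r n e i (Suc r) = \<B> (Suc r)"
    "n = 2 * r + 1 \<Longrightarrow> i = r \<Longrightarrow> tau'_B r n e i (Suc r) = qbr (- e) (\<B> r) (qbr e (\<B> (Suc r)) (\<B> (rho n r))) + \<B> (Suc r) * Kpow n (rho n r) e"
proof -
  have len: "i \<le> n" "j \<le> n" using assms n by auto
  have rho: "rho n (rho n i) = i" using assms by simp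
  have sum: "rho n i + i = n + 1" "rho n j + j = n + 1"
    using len by (simp_all add: rho_def)
  \<comment> \<open>Hence \<open>i\<close> and \<open>\<rho>(j)\<close> differ by at least two, and so do \<open>j\<close> and \<open>\<rho>(i)\<close>.\<close>
  have ij: "i + j < n" using assms n by (auto simp: NN_def)
  have le: "i \<le> r" "j \<le> r" using assms by auto
  have ne: "rho n i \<noteq> i" "rho n i \<noteq> j" "rho n j \<noteq> i" "rho n j \<noteq> j" "i \<noteq> rho n i"
    "i \<noteq> Suc r" "j \<noteq> Suc r" "Suc i \<noteq> rho n j" "rho n j \<noteq> Suc i" "rho n i \<noteq> Suc j" "Suc j \<noteq> rho n i"
    "i \<noteq> Suc (rho n j)" "i \<noteq> rho n j" "j \<noteq> Suc (rho n i)"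
    using sum ij le n by linarith+
  have odd: "rho n i \<noteq> Suc r" "rho n j \<noteq> Suc r" "Suc (Suc r) = rho n r" if "n = 2 * r + 1"
    using that le by (simp_all add: rho_def)
  have rho_eq: "(rho n i = rho n j) = (i = j)" "(rho n j = rho n i) = (i = j)"
    "(rho n i = Suc (rho n j)) = (j = Suc i)" "(rho n j = Suc (rho n i)) = (i = Suc j)"
    using sum by - (rule iffI; linarith)+
  have cdot: "cdot i (rho n j) = 0" "cdot (rho n i) j = 0" "cdot (rho n i) (rho n j) = cdot i j"
    "j = Suc i \<or> i = Suc j \<Longrightarrow> cdot i j = - 1"
    "j \<noteq> Suc i \<Longrightarrow> i \<noteq> Suc j \<Longrightarrow> cdot i j \<noteq> - 1"
    using ne by (simp_all add: cdot_def rho_eq) auto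
  show "tau'_B r n e i i = - (\<B> (rho n i) * Kpow n (rho n i) e)"
    using assms(1,2) ne odd rho by (auto simp: tau'_B_def)
  show "tau'_B r n e i (rho n i) = - (Kpow n i e * \<B> i)"
    using assms(1,2) ne odd rho by (auto simp: tau'_B_def)
  show "j = Suc i \<or> i = Suc j \<Longrightarrow> tau'_B r n e i j = qbr (- e) (\<B> i) (\<B> j)"
    using assms(1,2) ne odd by (auto simp: tau'_B_def cdot rho_eq)
  show "j = Suc i \<or> i = Suc j \<Longrightarrow> tau'_B r n e i (rho n j) = qbr e (\<B> (rho n j)) (\<B> (rho n i))"
    using assms(1,2) ne odd by (auto simp: tau'_B_def cdot rho_eq)
  show "j \<noteq> i \<Longrightarrow> j \<noteq> Suc i \<Longrightarrow> i \<noteq> Suc j \<Longrightarrow> tau'_B r n e i j = \<B> j"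
    using assms(1,2) ne odd by (auto simp: tau'_B_def cdot rho_eq)
  show "j \<noteq> i \<Longrightarrow> j \<noteq> Suc i \<Longrightarrow> i \<noteq> Suc j \<Longrightarrow> tau'_B r n e i (rho n j) = \<B> (rho n j)"
    using assms(1,2) ne odd by (auto simp: tau'_B_def cdot rho_eq)
  show "n = 2 * r + 1 \<Longrightarrow> i \<noteq> r \<Longrightarrow> tau'_B r n e i (Suc r) = \<B> (Suc r)"
    using assms by (auto simp: tau'_B_def cdot_def rho_def)
  show "n = 2 * r + 1 \<Longrightarrow> i = r \<Longrightarrow> tau'_B r n e i (Suc r) = qbr (- e) (\<B> r) (qbr e (\<B> (Suc r)) (\<B> (rho n r))) + \<B> (Suc r) * Kpow n (rho n r) e"
    using assms(1,2) ne odd rho by (auto simp: tau'_B_def)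
qed

lemma tau''_B_lt:
  assumes "i \<in> {1..r}" "i < NN n" "j \<in> {1..r}"
  shows "tau''_B r n e i i = - (Kpow n i e * \<B> (rho n i))"
    "tau''_B r n e i (rho n i) = - (\<B> i * Kpow n (rho n i) e)"
    "j = Suc i \<or> i = Suc j \<Longrightarrow> tau''_B r n e i j = qbr (- e) (\<B> j) (\<B> i)"
    "j = Suc i \<or> i = Suc j \<Longrightarrow> tau''_B r n e i (rho n j) = qbr e (\<B> (rho n i)) (\<B> (rho n j))"
    "j \<noteq> i \<Longrightarrow> j \<noteq> Suc i \<Longrightarrow> i \<noteq> Suc j \<Longrightarrow> tau''_B r n e i j = \<B> j"
    "j \<noteq> i \<Longrightarrow> j \<noteq> Suc i \<Longrightarrow> i \<noteq> Suc j \<Longrightarrow> tau''_B r n e i (rho n j) = \<B> (rho n j)"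
    "n = 2 * r + 1 \<Longrightarrow> i \<noteq> r \<Longrightarrow> tau''_B r n e i (Suc r) = \<B> (Suc r)"
    "n = 2 * r + 1 \<Longrightarrow> i = r \<Longrightarrow> tau''_B r n e i (Suc r) = qbr (- e) (qbr e (\<B> r) (\<B> (Suc r))) (\<B> (rho n r)) + \<B> (Suc r) * Kpow n (rho n r) e"
proof -
  have len: "i \<le> n" "j \<le> n" using assms n by auto
  have rho: "rho n (rho n i) = i" using assms by simp
  have sum: "rho n i + i = n + 1" "rho n j + j = n + 1"
    using len by (simp_all add: rho_def)
  \<comment> \<open>Hence \<open>i\<close> and \<open>\<rho>(j)\<close> differ by at least two, and so do \<open>j\<close> and \<open>\<rho>(i)\<close>.\<close>
  have ij: "i + j < n" using assms n by (auto simp: NN_def)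
  have le: "i \<le> r" "j \<le> r" using assms by auto
  have ne: "rho n i \<noteq> i" "rho n i \<noteq> j" "rho n j \<noteq> i" "rho n j \<noteq> j" "i \<noteq> rho n i"
    "i \<noteq> Suc r" "j \<noteq> Suc r" "Suc i \<noteq> rho n j" "rho n j \<noteq> Suc i" "rho n i \<noteq> Suc j" "Suc j \<noteq> rho n i"
    "i \<noteq> Suc (rho n j)" "i \<noteq> rho n j" "j \<noteq> Suc (rho n i)"
    using sum ij le n by linarith+
  have odd: "rho n i \<noteq> Suc r" "rho n j \<noteq> Suc r" "Suc (Suc r) = rho n r" if "n = 2 * r + 1"
    using that le by (simp_all add: rho_def)
  have rho_eq: "(rho n i = rho n j) = (i = j)" "(rho n j = rho n i) = (i = j)"
    "(rho n i = Suc (rho n j)) = (j = Suc i)" "(rho n j = Suc (rho n i)) = (i = Suc j)"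
    using sum by - (rule iffI; linarith)+
  have cdot: "cdot i (rho n j) = 0" "cdot (rho n i) j = 0" "cdot (rho n i) (rho n j) = cdot i j"
    "j = Suc i \<or> i = Suc j \<Longrightarrow> cdot i j = - 1"
    "j \<noteq> Suc i \<Longrightarrow> i \<noteq> Suc j \<Longrightarrow> cdot i j \<noteq> - 1"
    using ne by (simp_all add: cdot_def rho_eq) auto
  show "tau''_B r n e i i = - (Kpow n i e * \<B> (rho n i))"
    using assms(1,2) ne odd rho by (auto simp: tau''_B_def)
  show "tau''_B r n e i (rho n i) = - (\<B> i * Kpow n (rho n i) e)"
    using assms(1,2) ne odd rho by (auto simp: tau''_B_def)
  show "j = Suc i \<or> i = Suc j \<Longrightarrow> tau''_B r n e i j = qbr (- e) (\<B> j) (\<B> i)"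
    using assms(1,2) ne odd by (auto simp: tau''_B_def cdot rho_eq)
  show "j = Suc i \<or> i = Suc j \<Longrightarrow> tau''_B r n e i (rho n j) = qbr e (\<B> (rho n i)) (\<B> (rho n j))"
    using assms(1,2) ne odd by (auto simp: tau''_B_def cdot rho_eq)
  show "j \<noteq> i \<Longrightarrow> j \<noteq> Suc i \<Longrightarrow> i \<noteq> Suc j \<Longrightarrow> tau''_B r n e i j = \<B> j"
    using assms(1,2) ne odd by (auto simp: tau''_B_def cdot rho_eq)
  show "j \<noteq> i \<Longrightarrow> j \<noteq> Suc i \<Longrightarrow> i \<noteq> Suc j \<Longrightarrow> tau''_B r n e i (rho n j) = \<B> (rho n j)"
    using assms(1,2) ne odd by (auto simp: tau''_B_def cdot rho_eq)
  show "n = 2 * r + 1 \<Longrightarrow> i \<noteq> r \<Longrightarrow> tau''_B r n e i (Suc r) = \<B> (Suc r)"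
    using assms by (auto simp: tau''_B_def cdot_def rho_def)
  show "n = 2 * r + 1 \<Longrightarrow> i = r \<Longrightarrow> tau''_B r n e i (Suc r) = qbr (- e) (qbr e (\<B> r) (\<B> (Suc r))) (\<B> (rho n r)) + \<B> (Suc r) * Kpow n (rho n r) e"
    using assms(1,2) ne odd rho by (auto simp: tau''_B_def)
qed

lemma phi_tau'_lt:
  assumes i: "i \<in> {1..r}" "i < NN n"
  shows "j \<in> {1..r} \<Longrightarrow> cls W (T'_X r n e i (Suc j)) \<otimes>\<^bsub>palg W\<^esub> cls W (T'_D r n e i j) =
      \<phi> (cls U (tau'_B r n e i j))" (is "_ \<Longrightarrow> ?B")
    and "j \<in> {1..r} \<Longrightarrow> cls W (T'_X r n e i j) \<otimes>\<^bsub>palg W\<^esub> cls W (T'_D r n e i (Suc j)) =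
      \<phi> (cls U (tau'_B r n e i (rho n j)))" (is "_ \<Longrightarrow> ?B_rho")
    and "n = 2 * r + 1 \<Longrightarrow> cls W (T'_X r n e i (Suc r)) \<otimes>\<^bsub>palg W\<^esub> cls W (T'_D r n e i (Suc r)) =
      \<phi> (cls U (tau'_B r n e i (Suc r)))"
proof -
  note images = T'_X_def T'_D_def phi_B phi_Kpow q_powers s_one brk_def
  have "n = 2 * r + 1 \<or> i \<noteq> r" using i n by (auto simp: NN_def)
  then have wt: "v powi cwt r n i = v" "v powi cwt r n (Suc i) = v" "kappa i = 0"
    using i powi_weight(1)[of i] powi_weight(1)[of "Suc i"] by (simp_all add: kappa_def) presburger
  {
    assume j: "j \<in> {1..r}"
    consider "j = i" | "j = Suc i" | "i = Suc j" | "j \<noteq> i" "j \<noteq> Suc i" "i \<noteq> Suc j" by blast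
    then have "?B \<and> ?B_rho"
    proof cases
      case 1
      then show ?thesis using i j wt T'_B[of i] T'_B_rho[of i]
        by (simp add: images tau'_B_lt[OF i j])
    next
      case 2
      then have near: "j = Suc i \<or> i = Suc j" by blast
      show ?thesis unfolding tau'_B_lt(3,4)[OF i j near]
        using 2 i j wt T'_B_next[of i] T'_B_rho_next[of i] by (simp add: images)
    next
      case 3
      then have near: "j = Suc i \<or> i = Suc j" by blast
      show ?thesis unfolding tau'_B_lt(3,4)[OF i j near]
        using 3 i j wt T'_B_prev[of j] T'_B_rho_prev[of j] by (simp add: images)
    next
      case 4
      then show ?thesis using i j
        by (simp add: images tau'_B_lt[OF i j])
    qed
  }
  then show "j \<in> {1..r} \<Longrightarrow> ?B" "j \<in> {1..r} \<Longrightarrow> ?B_rho" by blast+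
next
  assume odd: "n = 2 * r + 1"
  note images = T'_X_def T'_D_def phi_B(1,2) phi_B(3)[OF odd] phi_Kpow q_powers s_one brk_def
  have wt: "v powi cwt r n i = v" "v powi cwt r n (Suc i) = v"
    by (rule powi_weight(1)[OF disjI1[OF odd]])+
  have closed: "kappa i = 0" "Suc r \<le> n"
    using odd unfolding kappa_def by simp_all
  show "cls W (T'_X r n e i (Suc r)) \<otimes>\<^bsub>palg W\<^esub> cls W (T'_D r n e i (Suc r)) =
      \<phi> (cls U (tau'_B r n e i (Suc r)))"
  proof (cases "i = r")
    case True
    then show ?thesis unfolding tau'_B_lt(8)[OF i i(1) odd True]
      using i wt closed T'_B_middle[of i] by (simp add: images)
  next
    case False
    then show ?thesis using i by (simp add: images tau'_B_lt(7)[OF i i(1) odd False])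
  qed
qed

lemma phi_tau''_lt:
  assumes i: "i \<in> {1..r}" "i < NN n"
  shows "j \<in> {1..r} \<Longrightarrow> cls W (T''_X r n e i (Suc j)) \<otimes>\<^bsub>palg W\<^esub> cls W (T''_D r n e i j) =
      \<phi> (cls U (tau''_B r n e i j))" (is "_ \<Longrightarrow> ?B")
    and "j \<in> {1..r} \<Longrightarrow> cls W (T''_X r n e i j) \<otimes>\<^bsub>palg W\<^esub> cls W (T''_D r n e i (Suc j)) =
      \<phi> (cls U (tau''_B r n e i (rho n j)))" (is "_ \<Longrightarrow> ?B_rho")
    and "n = 2 * r + 1 \<Longrightarrow> cls W (T''_X r n e i (Suc r)) \<otimes>\<^bsub>palg W\<^esub> cls W (T''_D r n e i (Suc r)) =
      \<phi> (cls U (tau''_B r n e i (Suc r)))"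
proof -
  note images = T''_X_def T''_D_def phi_B phi_Kpow q_powers s_one brk_def
  have "n = 2 * r + 1 \<or> i \<noteq> r" using i n by (auto simp: NN_def)
  then have wt: "v powi cwt r n i = v" "v powi cwt r n (Suc i) = v" "kappa i = 0"
    using i powi_weight(1)[of i] powi_weight(1)[of "Suc i"] by (simp_all add: kappa_def) presburger
  {
    assume j: "j \<in> {1..r}"
    consider "j = i" | "j = Suc i" | "i = Suc j" | "j \<noteq> i" "j \<noteq> Suc i" "i \<noteq> Suc j" by blast
    then have "?B \<and> ?B_rho"
    proof cases
      case 1
      then show ?thesis using i j wt T''_B[of i] T''_B_rho[of i]
        by (simp add: images tau''_B_lt[OF i j])
    next
      case 2
      then have near: "j = Suc i \<or> i = Suc j" by blast
      show ?thesis unfolding tau''_B_lt(3,4)[OF i j near]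
        using 2 i j wt T''_B_next[of i] T''_B_rho_next[of i] by (simp add: images)
    next
      case 3
      then have near: "j = Suc i \<or> i = Suc j" by blast
      show ?thesis unfolding tau''_B_lt(3,4)[OF i j near]
        using 3 i j wt T''_B_prev[of j] T''_B_rho_prev[of j] by (simp add: images)
    next
      case 4
      then show ?thesis using i j
        by (simp add: images tau''_B_lt[OF i j])
    qed
  }
  then show "j \<in> {1..r} \<Longrightarrow> ?B" "j \<in> {1..r} \<Longrightarrow> ?B_rho" by blast+
next
  assume odd: "n = 2 * r + 1"
  note images = T''_X_def T''_D_def phi_B(1,2) phi_B(3)[OF odd] phi_Kpow q_powers s_one brk_def
  have wt: "v powi cwt r n i = v" "v powi cwt r n (Suc i) = v"
    by (rule powi_weight(1)[OF disjI1[OF odd]])+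
  have closed: "kappa i = 0" "Suc r \<le> n"
    using odd unfolding kappa_def by simp_all
  show "cls W (T''_X r n e i (Suc r)) \<otimes>\<^bsub>palg W\<^esub> cls W (T''_D r n e i (Suc r)) =
      \<phi> (cls U (tau''_B r n e i (Suc r)))"
  proof (cases "i = r")
    case True
    then show ?thesis unfolding tau''_B_lt(8)[OF i i(1) odd True]
      using i wt closed T''_B_middle[of i] by (simp add: images)
  next
    case False
    then show ?thesis using i by (simp add: images tau''_B_lt(7)[OF i i(1) odd False])
  qed
qed

section \<open>The last node \<open>i = N\<close>\<close>

text \<open>Here \<open>N = r + 1\<close>, and \<open>\<tau>\<^sub>N\<close> moves only the two neighbours \<open>B\<^sub>r\<close> and \<open>B\<^sub>r\<^sub>+\<^sub>2\<close> of the fixed index of \<open>\<rho>\<close>.\<close>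

lemma phi_tau'_odd:
  assumes odd: "n = 2 * r + 1" and i: "i = NN n"
  shows "j \<in> {1..r} \<Longrightarrow> cls W (T'_X r n e i (Suc j)) \<otimes>\<^bsub>palg W\<^esub> cls W (T'_D r n e i j) =
      \<phi> (cls U (tau'_B r n e i j))"
    and "j \<in> {1..r} \<Longrightarrow> cls W (T'_X r n e i j) \<otimes>\<^bsub>palg W\<^esub> cls W (T'_D r n e i (Suc j)) =
      \<phi> (cls U (tau'_B r n e i (rho n j)))"
    and "cls W (T'_X r n e i (Suc r)) \<otimes>\<^bsub>palg W\<^esub> cls W (T'_D r n e i (Suc r)) =
      \<phi> (cls U (tau'_B r n e i (Suc r)))"
proof -
  note images = T'_X_def T'_D_def phi_B(1,2) phi_B(3)[OF odd] q_powers brk_def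
  have I: "r \<in> {1..r + 1}" "Suc r \<in> {1..r + 1}" "Suc r \<le> n"
    using r odd by auto
  have wt: "v powi cwt r n (Suc r) = v"
    by (rule powi_weight(1)[OF disjI1[OF odd]])
  have NN: "\<not> i < NN n" "n \<noteq> 2 * r" using i odd by auto
  have rho_r: "rho n r = r + 2" using odd by (simp add: rho_def)
  show "cls W (T'_X r n e i (Suc j)) \<otimes>\<^bsub>palg W\<^esub> cls W (T'_D r n e i j) =
      \<phi> (cls U (tau'_B r n e i j))" if j: "j \<in> {1..r}"
  proof (cases "j = r")
    case True
    have tau: "tau'_B r n e i r = qbr (- e) (\<B> (Suc r)) (\<B> r)"
      using NN by (simp add: tau'_B_def)
    show ?thesis using True j I wt NN T'_odd_N(1)[of r] by (simp add: images tau)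
  next
    case False
    then have tau: "tau'_B r n e i j = \<B> j"
      using NN j by (simp add: tau'_B_def)
    show ?thesis using False j NN by (simp add: images tau)
  qed
  show "cls W (T'_X r n e i j) \<otimes>\<^bsub>palg W\<^esub> cls W (T'_D r n e i (Suc j)) =
      \<phi> (cls U (tau'_B r n e i (rho n j)))" if j: "j \<in> {1..r}"
  proof (cases "j = r")
    case True
    have tau: "tau'_B r n e i (rho n r) = qbr e (\<B> (rho n r)) (\<B> (Suc r))"
      using NN rho_r by (simp add: tau'_B_def)
    show ?thesis using True j I wt NN T'_odd_N(2)[of r] by (simp add: images tau)
  next
    case False
    then have "rho n j \<noteq> r" "rho n j \<noteq> r + 2" using j odd by (auto simp: rho_def)
    then have tau: "tau'_B r n e i (rho n j) = \<B> (rho n j)"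
      using NN j by (simp add: tau'_B_def)
    show ?thesis using False j NN by (simp add: images tau)
  qed
  have tau: "tau'_B r n e i (Suc r) = \<B> (Suc r)"
    using NN by (simp add: tau'_B_def)
  show "cls W (T'_X r n e i (Suc r)) \<otimes>\<^bsub>palg W\<^esub> cls W (T'_D r n e i (Suc r)) =
      \<phi> (cls U (tau'_B r n e i (Suc r)))"
    using I wt NN T'_odd_N(3)[of r] by (simp add: images tau)
qed

lemma phi_tau''_odd:
  assumes odd: "n = 2 * r + 1" and i: "i = NN n"
  shows "j \<in> {1..r} \<Longrightarrow> cls W (T''_X r n e i (Suc j)) \<otimes>\<^bsub>palg W\<^esub> cls W (T''_D r n e i j) =
      \<phi> (cls U (tau''_B r n e i j))"
    and "j \<in> {1..r} \<Longrightarrow> cls W (T''_X r n e i j) \<otimes>\<^bsub>palg W\<^esub> cls W (T''_D r n e i (Suc j)) =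
      \<phi> (cls U (tau''_B r n e i (rho n j)))"
    and "cls W (T''_X r n e i (Suc r)) \<otimes>\<^bsub>palg W\<^esub> cls W (T''_D r n e i (Suc r)) =
      \<phi> (cls U (tau''_B r n e i (Suc r)))"
proof -
  note images = T''_X_def T''_D_def phi_B(1,2) phi_B(3)[OF odd] q_powers brk_def
  have I: "r \<in> {1..r + 1}" "Suc r \<in> {1..r + 1}" "Suc r \<le> n"
    using r odd by auto
  have wt: "v powi cwt r n (Suc r) = v"
    by (rule powi_weight(1)[OF disjI1[OF odd]])
  have NN: "\<not> i < NN n" "n \<noteq> 2 * r" using i odd by auto
  have rho_r: "rho n r = r + 2" using odd by (simp add: rho_def)
  show "cls W (T''_X r n e i (Suc j)) \<otimes>\<^bsub>palg W\<^esub> cls W (T''_D r n e i j) =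
      \<phi> (cls U (tau''_B r n e i j))" if j: "j \<in> {1..r}"
  proof (cases "j = r")
    case True
    have tau: "tau''_B r n e i r = qbr e (\<B> (Suc r)) (\<B> r)"
      using NN by (simp add: tau''_B_def)
    show ?thesis using True j I wt NN T''_odd_N(1)[of r] by (simp add: images tau)
  next
    case False
    then have tau: "tau''_B r n e i j = \<B> j"
      using NN j by (simp add: tau''_B_def)
    show ?thesis using False j NN by (simp add: images tau)
  qed
  show "cls W (T''_X r n e i j) \<otimes>\<^bsub>palg W\<^esub> cls W (T''_D r n e i (Suc j)) =
      \<phi> (cls U (tau''_B r n e i (rho n j)))" if j: "j \<in> {1..r}"
  proof (cases "j = r")
    case True
    have tau: "tau''_B r n e i (rho n r) = qbr (- e) (\<B> (rho n r)) (\<B> (Suc r))"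
      using NN rho_r by (simp add: tau''_B_def)
    show ?thesis using True j I wt NN T''_odd_N(2)[of r] by (simp add: images tau)
  next
    case False
    then have "rho n j \<noteq> r" "rho n j \<noteq> r + 2" using j odd by (auto simp: rho_def)
    then have tau: "tau''_B r n e i (rho n j) = \<B> (rho n j)"
      using NN j by (simp add: tau''_B_def)
    show ?thesis using False j NN by (simp add: images tau)
  qed
  have tau: "tau''_B r n e i (Suc r) = \<B> (Suc r)"
    using NN by (simp add: tau''_B_def)
  show "cls W (T''_X r n e i (Suc r)) \<otimes>\<^bsub>palg W\<^esub> cls W (T''_D r n e i (Suc r)) =
      \<phi> (cls U (tau''_B r n e i (Suc r)))"
    using I wt NN T''_odd_N(3)[of r] by (simp add: images tau)
qed

text \<open>Here \<open>N = r\<close>, and \<open>\<tau>\<^sub>N\<close> moves \<open>B\<^sub>j\<close> and \<open>B\<^bsub>\<rho>(j)\<^esub>\<close> for \<open>j = r\<close> and \<open>j = r - 1\<close> only.\<close>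

lemma phi_tau'_even:
  assumes even: "n = 2 * r" and i: "i = NN n" and j: "j \<in> {1..r}"
  shows "cls W (T'_X r n e i (Suc j)) \<otimes>\<^bsub>palg W\<^esub> cls W (T'_D r n e i j) =
      \<phi> (cls U (tau'_B r n e i j))"
    and "cls W (T'_X r n e i j) \<otimes>\<^bsub>palg W\<^esub> cls W (T'_D r n e i (Suc j)) =
      \<phi> (cls U (tau'_B r n e i (rho n j)))"
proof -
  note images = T'_X_def T'_D_def phi_B(1,2) phi_Kpow q_powers brk_def Mpow_two eqTrueI[OF even]
  have I: "r \<in> {1..r + 1}" "Suc r \<in> {1..r + 1}" "v powi cwt r n r = v" "v powi cwt r n (Suc r) = v * v"
    "kappa r = 1"
    using r powi_weight(1)[of r] powi_weight(2)[OF even] unfolding kappa_def by (simp_all add: even)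
  have NN: "\<not> i < NN n" using i by auto
  have rho_r: "rho n r = r + 1" using even by (simp add: rho_def)
  have rho_j: "rho n j = 2 * r + 1 - j" using even by (simp add: rho_def)
  consider "j = r" | "Suc j = r" | "j < r - 1" using j by force
  then have "cls W (T'_X r n e i (Suc j)) \<otimes>\<^bsub>palg W\<^esub> cls W (T'_D r n e i j) =
      \<phi> (cls U (tau'_B r n e i j)) \<and>
    cls W (T'_X r n e i j) \<otimes>\<^bsub>palg W\<^esub> cls W (T'_D r n e i (Suc j)) =
      \<phi> (cls U (tau'_B r n e i (rho n j)))"
  proof cases
    case 1
    have tau: "tau'_B r n e i r = Kpow n r e * \<B> r" "tau'_B r n e i (rho n r) = \<B> (rho n r) * Kpow n (rho n r) e"
      using NN even r rho_r by (auto simp: tau'_B_def)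
    show ?thesis using 1 j I NN T_even_N_B(1)[of r] T_even_N_B(2)[of r] by (simp add: images tau)
  next
    case 2
    then have eq: "j = r - 1" "rho n j = r + 2" "rho n j \<noteq> r" using rho_j by auto
    have tau: "tau'_B r n e i j = qs (- e) * qbr e (qbr e (\<B> j) (\<B> r)) (\<B> (rho n r)) - Kpow n r e * \<B> j"
      using NN even r rho_r eq(1) by (simp add: tau'_B_def)
    have tau_rho: "tau'_B r n e i (rho n j) = qs (- e) * qbr e (qbr e (\<B> (rho n j)) (\<B> (rho n r))) (\<B> r) - \<B> (rho n j) * Kpow n (rho n r) e"
      using NN even r rho_r eq(3) by (simp add: tau'_B_def flip: eq(2)) (use eq(2) in auto)
    show ?thesis using 2 j I NN T'_even_N_prev[of j, unfolded 2] T'_even_N_rho_prev[of j, unfolded 2]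
      by (simp add: images tau tau_rho)
  next
    case 3
    then have ne: "j \<noteq> r" "j \<noteq> r - 1" "j \<noteq> r + 1" "j \<noteq> r + 2" "Suc j \<noteq> r" "Suc j \<noteq> Suc r"
      "rho n j \<noteq> r" "rho n j \<noteq> r - 1" "rho n j \<noteq> r + 1" "rho n j \<noteq> r + 2"
      using rho_j j by auto
    then have tau: "tau'_B r n e i j = \<B> j" "tau'_B r n e i (rho n j) = \<B> (rho n j)"
      using NN even by (simp_all add: tau'_B_def)
    show ?thesis using ne j NN by (simp add: images tau)
  qed
  then show "cls W (T'_X r n e i (Suc j)) \<otimes>\<^bsub>palg W\<^esub> cls W (T'_D r n e i j) =
      \<phi> (cls U (tau'_B r n e i j))"
    "cls W (T'_X r n e i j) \<otimes>\<^bsub>palg W\<^esub> cls W (T'_D r n e i (Suc j)) =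
      \<phi> (cls U (tau'_B r n e i (rho n j)))" by blast+
qed

lemma phi_tau''_even:
  assumes even: "n = 2 * r" and i: "i = NN n" and j: "j \<in> {1..r}"
  shows "cls W (T''_X r n e i (Suc j)) \<otimes>\<^bsub>palg W\<^esub> cls W (T''_D r n e i j) =
      \<phi> (cls U (tau''_B r n e i j))"
    and "cls W (T''_X r n e i j) \<otimes>\<^bsub>palg W\<^esub> cls W (T''_D r n e i (Suc j)) =
      \<phi> (cls U (tau''_B r n e i (rho n j)))"
proof -
  note images = T''_X_def T''_D_def phi_B(1,2) phi_Kpow q_powers brk_def Mpow_two eqTrueI[OF even]
  have I: "r \<in> {1..r + 1}" "Suc r \<in> {1..r + 1}" "v powi cwt r n r = v" "v powi cwt r n (Suc r) = v * v"
    "kappa r = 1"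
    using r powi_weight(1)[of r] powi_weight(2)[OF even] unfolding kappa_def by (simp_all add: even)
  have NN: "\<not> i < NN n" using i by auto
  have rho_r: "rho n r = r + 1" using even by (simp add: rho_def)
  have rho_j: "rho n j = 2 * r + 1 - j" using even by (simp add: rho_def)
  consider "j = r" | "Suc j = r" | "j < r - 1" using j by force
  then have "cls W (T''_X r n e i (Suc j)) \<otimes>\<^bsub>palg W\<^esub> cls W (T''_D r n e i j) =
      \<phi> (cls U (tau''_B r n e i j)) \<and>
    cls W (T''_X r n e i j) \<otimes>\<^bsub>palg W\<^esub> cls W (T''_D r n e i (Suc j)) =
      \<phi> (cls U (tau''_B r n e i (rho n j)))"
  proof cases
    case 1
    have tau: "tau''_B r n e i r = Kpow n (rho n r) e * \<B> r" "tau''_B r n e i (rho n r) = \<B> (rho n r) * Kpow n r e"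
      using NN even r rho_r by (auto simp: tau''_B_def)
    show ?thesis using 1 j I NN T_even_N_B(3)[of r] T_even_N_B(4)[of r] by (simp add: images tau)
  next
    case 2
    then have eq: "j = r - 1" "rho n j = r + 2" "rho n j \<noteq> r" using rho_j by auto
    have tau: "tau''_B r n e i j = qs (- e) * qbr e (\<B> (rho n r)) (qbr e (\<B> r) (\<B> j)) - Kpow n (rho n r) e * \<B> j"
      using NN even r rho_r eq(1) by (simp add: tau''_B_def)
    have tau_rho: "tau''_B r n e i (rho n j) = qs (- e) * qbr e (\<B> r) (qbr e (\<B> (rho n r)) (\<B> (rho n j))) - \<B> (rho n j) * Kpow n r e"
      using NN even r rho_r eq(3) by (simp add: tau''_B_def flip: eq(2)) (use eq(2) in auto)
    show ?thesis using 2 j I NN T''_even_N_prev[of j, unfolded 2] T''_even_N_rho_prev[of j, unfolded 2]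
      by (simp add: images tau tau_rho)
  next
    case 3
    then have ne: "j \<noteq> r" "j \<noteq> r - 1" "j \<noteq> r + 1" "j \<noteq> r + 2" "Suc j \<noteq> r" "Suc j \<noteq> Suc r"
      "rho n j \<noteq> r" "rho n j \<noteq> r - 1" "rho n j \<noteq> r + 1" "rho n j \<noteq> r + 2"
      using rho_j j by auto
    then have tau: "tau''_B r n e i j = \<B> j" "tau''_B r n e i (rho n j) = \<B> (rho n j)"
      using NN even by (simp_all add: tau''_B_def)
    show ?thesis using ne j NN by (simp add: images tau)
  qed
  then show "cls W (T''_X r n e i (Suc j)) \<otimes>\<^bsub>palg W\<^esub> cls W (T''_D r n e i j) =
      \<phi> (cls U (tau''_B r n e i j))"
    "cls W (T''_X r n e i j) \<otimes>\<^bsub>palg W\<^esub> cls W (T''_D r n e i (Suc j)) =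
      \<phi> (cls U (tau''_B r n e i (rho n j)))" by blast+
qed

lemma phi_tau':
  assumes i: "i \<in> {1..NN n}" and \<tau>: "is_tau' r n e i \<tau>" and T: "is_T' r n e i T"
    and u: "u \<in> carrier (palg U)"
  shows "T (\<phi> u) = \<phi> (\<tau> u)"
proof (rule intertwine_images[OF _ _ _ _ _ i _ _ _ u])
  show "alg_aut U \<tau>" "\<forall>j\<in>{1..r}. \<tau> (cls U (\<K> j)) = cls U (tau_K n i j)"
      "\<forall>j\<in>{1..n}. \<tau> (cls U (\<B> j)) = cls U (tau'_B r n e i j)"
    using \<tau> unfolding is_tau'_def by blast+
  show "alg_aut W T" "\<forall>j\<in>{1..r + 1}. T (cls W (\<mm> j)) = cls W (T_M n i j) \<and>
      T (cls W (\<dd> j)) = cls W (T'_D r n e i j) \<and> T (cls W (\<xx> j)) = cls W (T'_X r n e i j)"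
    using T unfolding is_T'_def by blast+
  have cases: thesis
    if "i \<in> {1..r} \<Longrightarrow> i < NN n \<Longrightarrow> thesis" "n = 2 * r + 1 \<Longrightarrow> i = NN n \<Longrightarrow> thesis"
      "n = 2 * r \<Longrightarrow> i = NN n \<Longrightarrow> thesis" for thesis
  proof -
    have "i \<in> {1..r} \<and> i < NN n \<or> i = NN n" using i n by (auto simp: NN_def)
    then show thesis using n that by blast
  qed
  show "cls W (T'_X r n e i (Suc j)) \<otimes>\<^bsub>palg W\<^esub> cls W (T'_D r n e i j) =
      \<phi> (cls U (tau'_B r n e i j))" if "j \<in> {1..r}" for j
    by (rule cases; erule (1) phi_tau'_lt(1)[OF _ _ that] phi_tau'_odd(1)[OF _ _ that] phi_tau'_even(1)[OF _ _ that])
  show "cls W (T'_X r n e i j) \<otimes>\<^bsub>palg W\<^esub> cls W (T'_D r n e i (Suc j)) =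
      \<phi> (cls U (tau'_B r n e i (rho n j)))" if "j \<in> {1..r}" for j
    by (rule cases; erule (1) phi_tau'_lt(2)[OF _ _ that] phi_tau'_odd(2)[OF _ _ that] phi_tau'_even(2)[OF _ _ that])
  show "cls W (T'_X r n e i (Suc r)) \<otimes>\<^bsub>palg W\<^esub> cls W (T'_D r n e i (Suc r)) =
      \<phi> (cls U (tau'_B r n e i (Suc r)))" if "n = 2 * r + 1"
    by (rule cases; (erule (1) phi_tau'_lt(3)[OF _ _ that] phi_tau'_odd(3))?) (use that in simp)
qed

lemma phi_tau'':
  assumes i: "i \<in> {1..NN n}" and \<tau>: "is_tau'' r n e i \<tau>" and T: "is_T'' r n e i T"
    and u: "u \<in> carrier (palg U)"
  shows "T (\<phi> u) = \<phi> (\<tau> u)"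
proof (rule intertwine_images[OF _ _ _ _ _ i _ _ _ u])
  show "alg_aut U \<tau>" "\<forall>j\<in>{1..r}. \<tau> (cls U (\<K> j)) = cls U (tau_K n i j)"
      "\<forall>j\<in>{1..n}. \<tau> (cls U (\<B> j)) = cls U (tau''_B r n e i j)"
    using \<tau> unfolding is_tau''_def by blast+
  show "alg_aut W T" "\<forall>j\<in>{1..r + 1}. T (cls W (\<mm> j)) = cls W (T_M n i j) \<and>
      T (cls W (\<dd> j)) = cls W (T''_D r n e i j) \<and> T (cls W (\<xx> j)) = cls W (T''_X r n e i j)"
    using T unfolding is_T''_def by blast+
  have cases: thesis
    if "i \<in> {1..r} \<Longrightarrow> i < NN n \<Longrightarrow> thesis" "n = 2 * r + 1 \<Longrightarrow> i = NN n \<Longrightarrow> thesis"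
      "n = 2 * r \<Longrightarrow> i = NN n \<Longrightarrow> thesis" for thesis
  proof -
    have "i \<in> {1..r} \<and> i < NN n \<or> i = NN n" using i n by (auto simp: NN_def)
    then show thesis using n that by blast
  qed
  show "cls W (T''_X r n e i (Suc j)) \<otimes>\<^bsub>palg W\<^esub> cls W (T''_D r n e i j) =
      \<phi> (cls U (tau''_B r n e i j))" if "j \<in> {1..r}" for j
    by (rule cases; erule (1) phi_tau''_lt(1)[OF _ _ that] phi_tau''_odd(1)[OF _ _ that] phi_tau''_even(1)[OF _ _ that])
  show "cls W (T''_X r n e i j) \<otimes>\<^bsub>palg W\<^esub> cls W (T''_D r n e i (Suc j)) =
      \<phi> (cls U (tau''_B r n e i (rho n j)))" if "j \<in> {1..r}" for j
    by (rule cases; erule (1) phi_tau''_lt(2)[OF _ _ that] phi_tau''_odd(2)[OF _ _ that] phi_tau''_even(2)[OF _ _ that])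
  show "cls W (T''_X r n e i (Suc r)) \<otimes>\<^bsub>palg W\<^esub> cls W (T''_D r n e i (Suc r)) =
      \<phi> (cls U (tau''_B r n e i (Suc r)))" if "n = 2 * r + 1"
    by (rule cases; (erule (1) phi_tau''_lt(3)[OF _ _ that] phi_tau''_odd(3))?) (use that in simp)
qed

section \<open>The anti-automorphisms\<close>

text \<open>The anti-automorphisms do not fix \<open>q\<close>, so agreement on scalars is proved together with that on
  generators. On the generators, \<open>\<omega>\<close> sends \<open>\<xx>\<^sub>k \<dd>\<^sub>l\<close> to \<open>\<xx>\<^sub>l \<dd>\<^sub>k\<close>, which turns \<open>\<phi>(B\<^sub>j)\<close> into \<open>\<phi>(B\<^bsub>\<rho>(j)\<^esub>)\<close>.\<close>

lemma phi_Omega: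
  assumes \<Omega>: "is_Omega r n \<Omega>" and \<omega>: "is_omega r n \<omega>" and u: "u \<in> carrier (palg U)"
  shows "\<omega> (\<phi> u) = \<phi> (\<Omega> u)"
proof -
  have \<Omega>c: "\<Omega> a \<in> carrier (palg U)" if "a \<in> carrier (palg U)" for a
    using \<Omega> that bij_betwE unfolding is_Omega_def rat_alg_antiaut_def by blast
  have \<omega>c: "\<omega> b \<in> carrier (palg W)" if "b \<in> carrier (palg W)" for b
    using \<omega> that bij_betwE unfolding is_omega_def rat_alg_antiaut_def by blast
  have \<Omega>_hom: "\<Omega> (a \<oplus>\<^bsub>palg U\<^esub> a') = \<Omega> a \<oplus>\<^bsub>palg U\<^esub> \<Omega> a'" "\<Omega> (a \<otimes>\<^bsub>palg U\<^esub> a') = \<Omega> a' \<otimes>\<^bsub>palg U\<^esub> \<Omega> a"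
    if "a \<in> carrier (palg U)" "a' \<in> carrier (palg U)" for a a'
    using \<Omega> that unfolding is_Omega_def rat_alg_antiaut_def by blast+
  have \<omega>_hom: "\<omega> (b \<oplus>\<^bsub>palg W\<^esub> b') = \<omega> b \<oplus>\<^bsub>palg W\<^esub> \<omega> b'" "\<omega> (b \<otimes>\<^bsub>palg W\<^esub> b') = \<omega> b' \<otimes>\<^bsub>palg W\<^esub> \<omega> b"
    if "b \<in> carrier (palg W)" "b' \<in> carrier (palg W)" for b b'
    using \<omega> that unfolding is_omega_def rat_alg_antiaut_def by blast+
  note \<Omega>_facts = \<Omega>[unfolded is_Omega_def rat_alg_antiaut_def]
    and \<omega>_facts = \<omega>[unfolded is_omega_def rat_alg_antiaut_def]
  have one: "\<Omega> \<one>\<^bsub>palg U\<^esub> = \<one>\<^bsub>palg U\<^esub>" "\<omega> \<one>\<^bsub>palg W\<^esub> = \<one>\<^bsub>palg W\<^esub>"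
    using \<Omega>_facts apply blast
    using \<omega>_facts by blast
  have rat: "\<Omega> (cls U (scal (Qq_of_rat c))) = cls U (scal (Qq_of_rat c))"
      "\<omega> (cls W (scal (Qq_of_rat c))) = cls W (scal (Qq_of_rat c))" for c
    using \<Omega>_facts apply blast
    using \<omega>_facts by blast
  have q: "\<Omega> (cls U (scal qq)) = cls U (scal (inverse qq))" "\<omega> (cls W (scal qq)) = cls W (scal (inverse qq))"
    using \<Omega>_facts apply blast
    using \<omega>_facts by blast
  have gens: "\<omega> (x j) = d j" "\<omega> (d j) = x j" "\<omega> (cls W (\<mm> j)) = cls W (\<mm>inv j)" if "j \<in> {1..r + 1}" for j
    using \<omega> that unfolding is_omega_def by blast+
  have BK: "j \<in> {1..n} \<Longrightarrow> \<Omega> (cls U (\<B> j)) = cls U (\<B> (rho n j))"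
    "j \<in> Kidx n \<Longrightarrow> \<Omega> (cls U (\<K> j)) = cls U (\<K> (rho n j))" for j
    using \<Omega> unfolding is_Omega_def by blast+
  have minv: "\<omega> (cls W (\<mm>inv j)) = cls W (\<mm> j)" if j: "j \<in> {1..r + 1}" for j
  proof -
    have "cls W (\<mm>inv j) \<otimes>\<^bsub>palg W\<^esub> \<omega> (cls W (\<mm>inv j)) = \<one>\<^bsub>palg W\<^esub>"
      using j \<omega>_hom(2)[of "cls W (\<mm>inv j)" "cls W (\<mm> j)"] by (simp add: pos.mi_m one gens)
    then show ?thesis
      using j \<omega>c W.A.inv_unique[of "cls W (\<mm> j)" "cls W (\<mm>inv j)" "\<omega> (cls W (\<mm>inv j))"]
      by (simp add: pos.m_mi)
  qed
  note anti = \<Omega>c \<omega>c \<Omega>_hom \<omega>_hom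
  have inv_q: "\<omega> (cls W (scal (inverse qq))) = cls W (scal qq)"
  proof -
    have 1: "cls W (scal c) \<otimes>\<^bsub>palg W\<^esub> cls W (scal c') = \<one>\<^bsub>palg W\<^esub>" if "c * c' = 1" for c c'
      using that W.s_simps(2)[of c c'] by (simp add: W.s_simps(3))
    have "cls W (scal (inverse qq)) \<otimes>\<^bsub>palg W\<^esub> \<omega> (cls W (scal (inverse qq))) = \<one>\<^bsub>palg W\<^esub>"
      using \<omega>_hom(2)[of "cls W (scal (inverse qq))" "cls W (scal qq)"] 1[of "inverse qq" qq]
      by (simp add: qq_nonzero one q)
    then show ?thesis
      using \<omega>c W.A.inv_unique[of "cls W (scal qq)" "cls W (scal (inverse qq))" "\<omega> (cls W (scal (inverse qq)))"]
        1[of qq "inverse qq"] by (simp add: qq_nonzero)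
  qed
  have q_inv: "\<omega> (cls W (scal (qq powi kappa j))) = cls W (scal (qq powi (- kappa j)))"
    "\<omega> (cls W (scal (qq powi (- kappa j)))) = cls W (scal (qq powi kappa j))" for j
  proof -
    have "kappa j = 0 \<or> kappa j = 1" unfolding kappa_def by simp
    then show "\<omega> (cls W (scal (qq powi kappa j))) = cls W (scal (qq powi (- kappa j)))"
      "\<omega> (cls W (scal (qq powi (- kappa j)))) = cls W (scal (qq powi kappa j))"
      using q(2) one(2) inv_q
      by (auto simp only: power_int_minus power_int_0_right power_int_1_right inverse_1 W.s_simps(3))
  qed
  \<comment> \<open>Scalars commute with each other, so the scalars of agreement are closed under products as well
    as sums, and under inverses since both maps are unital.\<close>
  have scal: "\<omega> (cls W (scal c)) = \<phi> (\<Omega> (cls U (scal c)))" for c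
  proof (induction c rule: Qq_induct)
    case (inverse c)
    have "cls W (scal (inverse c)) \<otimes>\<^bsub>palg W\<^esub> cls W (scal c) = \<one>\<^bsub>palg W\<^esub>"
      "cls U (scal c) \<otimes>\<^bsub>palg U\<^esub> cls U (scal (inverse c)) = \<one>\<^bsub>palg U\<^esub>"
      using inverse(2) W.s_simps(2)[of "inverse c" c] U.s_simps(2)[of c "inverse c"]
      by (simp_all add: W.s_simps(3) U.s_simps(3))
    then have "\<omega> (cls W (scal c)) \<otimes>\<^bsub>palg W\<^esub> \<omega> (cls W (scal (inverse c))) = \<one>\<^bsub>palg W\<^esub>"
      "\<phi> (\<Omega> (cls U (scal (inverse c)))) \<otimes>\<^bsub>palg W\<^esub> \<phi> (\<Omega> (cls U (scal c))) = \<one>\<^bsub>palg W\<^esub>"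
      by (simp_all add: one anti flip: \<omega>_hom(2) \<Omega>_hom(2) phi.hom_simps(3))
    then show ?case
      using inverse(1) W.A.inv_unique[of "\<phi> (\<Omega> (cls U (scal (inverse c))))" "\<phi> (\<Omega> (cls U (scal c)))"
          "\<omega> (cls W (scal (inverse c)))"]
      by (simp add: anti)
  qed (simp_all add: rat q anti W.s_simps(1,2) U.s_simps(1,2))
  show ?thesis using u
  proof (induction rule: U.palg_induct)
    case (gen g)
    show ?case
    proof (cases g)
      case (Bgen j)
      then have j: "j \<in> {1..n}" using gen by simp
      then have "\<omega> (\<phi> (cls U (\<B> j))) = \<phi> (\<Omega> (cls U (\<B> j)))"
      proof (cases rule: B_index_cases)
        case 1
        then show ?thesis by (simp add: BK phi_B anti gens)
      next
        case (2 k)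
        then show ?thesis by (simp add: BK phi_B anti gens)
      next
        case 3
        then have "rho n j = j" by (simp add: rho_def)
        then show ?thesis using BK(1)[OF j] phi_B(3)[OF 3(1)] 3(2) by (simp add: anti gens)
      qed
      then show ?thesis unfolding Bgen .
    next
      case (Kgen j)
      then have "j \<in> {1..r} \<or> j \<in> rho n ` {1..r}" using gen by (simp add: Kidx_iff)
      then obtain k where k: "k \<in> {1..r}" and "j = k \<or> j = rho n k" by blast
      have K: "k \<in> Kidx n" "rho n k \<in> Kidx n" using k by (auto simp: Kidx_iff)
      from \<open>j = k \<or> j = rho n k\<close> show ?thesis
      proof
        assume "j = k"
        then show ?thesis using Kgen K k
          by (simp add: BK phi_K anti gens minv q_inv W.s_central)
      next
        assume "j = rho n k"
        then show ?thesis using Kgen K k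
          by (simp add: BK phi_K anti gens minv q_inv W.s_central)
      qed
    qed
  qed (simp_all add: anti scal)
qed

end

section \<open>The intertwining theorem\<close>

theorem theorem3p7:
  fixes r n :: nat and e :: int
    and \<phi> :: "ugen freealg set \<Rightarrow> agen freealg set"
    and \<Omega> :: "ugen freealg set \<Rightarrow> ugen freealg set"
    and \<omega> :: "agen freealg set \<Rightarrow> agen freealg set"
  assumes "r \<ge> 1" and "n = 2 * r \<or> n = 2 * r + 1" and "e \<in> {1, -1}"
    and "is_phi r n \<phi>"
    and "is_Omega r n \<Omega>"
    and "is_omega r n \<omega>"
  shows "(\<forall>u \<in> carrier (palg (iqg r n)). \<omega> (\<phi> u) = \<phi> (\<Omega> u)) \<and>
         (\<forall>i \<in> {1..(n + 1) div 2}. \<forall>\<tau> T.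
            is_tau' r n e i \<tau> \<and> is_T' r n e i T \<or> is_tau'' r n e i \<tau> \<and> is_T'' r n e i T \<longrightarrow>
            (\<forall>u \<in> carrier (palg (iqg r n)). T (\<phi> u) = \<phi> (\<tau> u)))"
proof -
  interpret phi_setting r n e \<phi>
    using assms(1-4) by unfold_locales
  show ?thesis
  proof (intro conjI ballI allI impI)
    show "\<omega> (\<phi> u) = \<phi> (\<Omega> u)" if "u \<in> carrier (palg (iqg r n))" for u
      by (rule phi_Omega[OF assms(5,6) that])
    fix i \<tau> T u
    assume i: "i \<in> {1..(n + 1) div 2}" and u: "u \<in> carrier (palg (iqg r n))"
      and "is_tau' r n e i \<tau> \<and> is_T' r n e i T \<or> is_tau'' r n e i \<tau> \<and> is_T'' r n e i T"
    from this(3) show "T (\<phi> u) = \<phi> (\<tau> u)"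
      using phi_tau'[OF i[folded NN_def] _ _ u] phi_tau''[OF i[folded NN_def] _ _ u] by (elim disjE conjE)
  qed
qed

end
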